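(* Let $\Lambda_8\subset\mathbb{R}^8$ be the lattice generated by $2\varepsilon_1,2\varepsilon_2,2\varepsilon_3$, $\varepsilon_1+\varepsilon_2+\varepsilon_3+\varepsilon_4$, $2\varepsilon_5$, $\varepsilon_1+\varepsilon_2+\varepsilon_5+\varepsilon_6$, $\varepsilon_1+\varepsilon_3+\varepsilon_5+\varepsilon_7$, $\varepsilon_2+\varepsilon_4+\varepsilon_6+\varepsilon_8$. Every integral lattice $M\subset\mathbb{R}^8$ with $\Lambda_8\subseteq M$ is isometric to one of the nine lattices $\Lambda_8$, $\Lambda_8(\varepsilon_1)$, $\Lambda_8(\varepsilon_1,\varepsilon_2)$, $\Lambda_8(\varepsilon_1,\varepsilon_2,\varepsilon_3)$, $\mathbb{Z}^8$, $(\bm{A}_1)^8$, $(\bm{D}_4)^2$, $\bm{D}_8$, $\bm{E}_8$.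
   Context: $\varepsilon_1,\dots,\varepsilon_8$ is the standard orthonormal basis of $\mathbb{R}^8$. A lattice is integral if all inner products of its vectors are integers. $L(x_1,\dots,x_k)$ denotes the lattice generated by $L$ and $x_1,\dots,x_k$. $(\bm{A}_1)^8=\langle\pm(\varepsilon_{2i-1}\pm\varepsilon_{2i}):1\le i\le4\rangle$; $(\bm{D}_4)^2=\langle\pm\varepsilon_i\pm\varepsilon_j: 1\le i<j\le4 \text{ or } 5\le i<j\le 8\rangle$; $\bm{D}_8=\langle\pm\varepsilon_i\pm\varepsilon_j:1\le i<j\le8\rangle$; $\bm{E}_8=\langle \bm{D}_8,\tfrac12(\varepsilon_1+\dots+\varepsilon_8)\rangle$.
   Formalization: The sixth lattice (A_1)^8 is replaced by Λ_8((A_1)^8), the lattice generated by Λ_8 and (A_1)^8; as written the claim fails for M = Λ_8(ε_1+ε_2), an even integral lattice of determinant 64 isometric to none of the nine. *)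

theory Defs
  imports "HOL-Analysis.Analysis"
begin

text \<open>\<open>\<epsilon> 1, \<dots>, \<epsilon> 8\<close> are the standard basis vectors. The index type \<open>8\<close> consists of the
  residues modulo 8, so \<open>\<epsilon> 8\<close> is the axis at index \<open>0\<close>.\<close>

definition \<epsilon> :: "nat \<Rightarrow> real ^ 8" where
  "\<epsilon> i = axis (of_nat i) 1"

definition int_span :: "'a::real_vector set \<Rightarrow> 'a set" where
  "int_span = module.span (\<lambda>(k::int) x. of_int k *\<^sub>R x)"

lemma module_int: "module (\<lambda>(k::int) (x::'a::real_vector). of_int k *\<^sub>R x)"
  by unfold_locales (auto simp: algebra_simps)

text \<open>No full-rank condition is imposed; any lattice containing \<open>\<Lambda>\<^sub>8\<close> below has full rank.\<close>

definition is_lattice :: "'a::euclidean_space set \<Rightarrow> bool" where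
  "is_lattice L \<longleftrightarrow> (\<exists>B. independent B \<and> L = int_span B)"

definition integral_lattice :: "'a::euclidean_space set \<Rightarrow> bool" where
  "integral_lattice L \<longleftrightarrow> is_lattice L \<and> (\<forall>x\<in>L. \<forall>y\<in>L. x \<bullet> y \<in> \<int>)"

definition isometric_lattices :: "'a::euclidean_space set \<Rightarrow> 'a set \<Rightarrow> bool" where
  "isometric_lattices L N \<longleftrightarrow> (\<exists>f. orthogonal_transformation f \<and> f ` L = N)"

text \<open>\<open>adjoin L {x\<^sub>1, \<dots>, x\<^sub>k}\<close> is $L(x_1,\dots,x_k)$.\<close>

definition adjoin :: "'a::real_vector set \<Rightarrow> 'a set \<Rightarrow> 'a set" where
  "adjoin L X = int_span (L \<union> X)"

definition Lambda8 :: "(real ^ 8) set" where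
  "Lambda8 = int_span
     {2 *\<^sub>R \<epsilon> 1, 2 *\<^sub>R \<epsilon> 2, 2 *\<^sub>R \<epsilon> 3,
      \<epsilon> 1 + \<epsilon> 2 + \<epsilon> 3 + \<epsilon> 4,
      2 *\<^sub>R \<epsilon> 5,
      \<epsilon> 1 + \<epsilon> 2 + \<epsilon> 5 + \<epsilon> 6,
      \<epsilon> 1 + \<epsilon> 3 + \<epsilon> 5 + \<epsilon> 7,
      \<epsilon> 2 + \<epsilon> 4 + \<epsilon> 6 + \<epsilon> 8}"

definition Z8 :: "(real ^ 8) set" where
  "Z8 = {x. \<forall>i. x $ i \<in> \<int>}"

text \<open>The root lattice of type $(A_1)^8$ has determinant $2^8$, the same as \<open>Lambda8\<close>, and does not
  contain \<open>Lambda8\<close>: it omits $\varepsilon_1+\varepsilon_3+\varepsilon_5+\varepsilon_7$. The lattice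
  with root system $(A_1)^8$ that lies over \<open>Lambda8\<close> is \<open>adjoin Lambda8 A1_8\<close>, which has
  determinant $2^6$ and contains \<open>A1_8\<close> with index 2. In contrast, \<open>D4_2\<close>, \<open>D8\<close> and \<open>E8\<close> do
  contain \<open>Lambda8\<close>.\<close>

definition A1_8 :: "(real ^ 8) set" where
  "A1_8 = int_span {s *\<^sub>R (\<epsilon> (2 * i - 1) + t *\<^sub>R \<epsilon> (2 * i)) | s t i.
     s \<in> {1, -1} \<and> t \<in> {1, -1} \<and> i \<in> {1..4}}"

definition D4_2 :: "(real ^ 8) set" where
  "D4_2 = int_span {s *\<^sub>R \<epsilon> i + t *\<^sub>R \<epsilon> j | s t i j.
     s \<in> {1, -1} \<and> t \<in> {1, -1} \<and> (1 \<le> i \<and> i < j \<and> j \<le> 4 \<or> 5 \<le> i \<and> i < j \<and> j \<le> 8)}"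

definition D8 :: "(real ^ 8) set" where
  "D8 = int_span {s *\<^sub>R \<epsilon> i + t *\<^sub>R \<epsilon> j | s t i j.
     s \<in> {1, -1} \<and> t \<in> {1, -1} \<and> 1 \<le> i \<and> i < j \<and> j \<le> 8}"

definition E8 :: "(real ^ 8) set" where
  "E8 = adjoin D8 {(1/2) *\<^sub>R (\<Sum>i=1..8. \<epsilon> i)}"

end

theory Submission
  imports Defs
begin

text \<open>
  Since \<open>Lambda8\<close> arises from the extended Hamming code, it is $\sqrt2$ times $E_8$ and its dual
  is $\frac12\Lambda_8$; every integral $M\supseteq\Lambda_8$ lies in that dual. Reflections in norm-1
  vectors of $\frac12\Lambda_8$ preserve \<open>Lambda8\<close>.

  If $M$ contains a vector of odd norm, such reflections bring $\varepsilon_1$ into $M$, and then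
  inductively $\varepsilon_2$, $\varepsilon_3$ and all remaining $\varepsilon_i$, until $M$ is generated by
  \<open>Lambda8\<close> and the $\varepsilon_i$ obtained so far. If $M$ is even but its dual contains a vector $v$
  of odd norm, then $M$ is the set of vectors of even norm in the odd lattice $M+\mathbb{Z}v$, which
  has just been classified. Otherwise $M$ is even and self-dual. Its odd neighbour
  $\{x\in M : x\cdot\varepsilon_1\in\mathbb{Z}\}+\mathbb{Z}\varepsilon_1$ is then isometric to
  $\mathbb{Z}^8$, so up to isometry $M$ contains $D_8$, and $M$ is one of the two copies of $E_8$ over
  $D_8$, which are exchanged by the reflection in $\varepsilon_8$.
\<close>

subsection \<open>Coordinates and duals\<close>

text \<open>A finite geometry predicts the number nine. Since M lies between \<open>Lambda8\<close>
  and its half, it corresponds to a subspace of the quotient F_2^8, on which x.x mod 2 is a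
  nondegenerate quadratic form of plus type with polar form 2(x.y) mod 2. M is integral iff the
  subspace is totally isotropic for the polar form; its dimension k is then at most 4 and M has
  determinant 2^(8-2k). On it x.x mod 2 is linear: zero if M is even (k = 0..4), nonzero if M is odd
  (k = 1..4). The unit reflections induce the full orthogonal group, so Witt's theorem gives one
  orbit per type, 5 + 4 in all. The proof replaces Witt's theorem by explicit moves along codewords.
  Even lattices contain no \<epsilon>_i to move, which is why they are reached as even parts of odd
  ones.\<close>

interpretation int_mod: module "\<lambda>(k::int) (x::'a::real_vector). of_int k *\<^sub>R x"
  by (rule module_int)

lemma int_span_eq: "int_span = int_mod.span"
  by (simp add: int_span_def)

lemma of_nat_image_8: "(of_nat :: nat \<Rightarrow> 8) ` {1..8} = UNIV"
proof -
  have "x \<in> (of_nat :: nat \<Rightarrow> 8) ` {1..8}" for x :: 8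
  proof -
    obtain z where 1: "x = of_int z" and z: "0 \<le> z" "z < 8"
      by (cases x rule: bit0_cases) simp
    show ?thesis
    proof (cases "z = 0")
      case True
      then have "x = of_nat 8" using 1 by simp
      then show ?thesis by force
    next
      case False
      then have "x = of_nat (nat z)" "nat z \<in> {1..8}" using 1 z by auto
      then show ?thesis by blast
    qed
  qed
  then show ?thesis by blast
qed

lemma inj_of_nat_8: "inj_on (of_nat :: nat \<Rightarrow> 8) {1..8}"
  by (rule eq_card_imp_inj_on) (simp_all only: of_nat_image_8, simp_all)

text \<open>Keeps the index \<open>1\<close> from turning into \<open>Suc 0\<close>, so that all
  eight indices remain numerals.\<close>

declare One_nat_def [simp del]

lemma inner_eps: "x \<bullet> \<epsilon> i = x $ of_nat i"
  by (simp add: \<epsilon>_def inner_axis)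

lemma eps_inner_eps [simp]:
  "i \<in> {1..8} \<Longrightarrow> j \<in> {1..8} \<Longrightarrow> \<epsilon> i \<bullet> \<epsilon> j = (if i = j then 1 else 0)"
  using inj_on_eq_iff[OF inj_of_nat_8, of i j] by (simp add: \<epsilon>_def inner_axis_axis)

lemma inner_eps_expand: "x \<bullet> y = (\<Sum>i=1..8. (x \<bullet> \<epsilon> i) * (y \<bullet> \<epsilon> i))"
proof -
  have "x \<bullet> y = (\<Sum>j\<in>UNIV. x $ j * y $ j)"
    by (simp add: inner_vec_def)
  also have "\<dots> = (\<Sum>i=1..8. x $ of_nat i * y $ of_nat i)"
    by (rule sum.reindex_cong[OF inj_of_nat_8]) (simp_all only: of_nat_image_8)
  finally show ?thesis by (simp add: inner_eps)
qed

lemma set8: "{1..8::nat} = {1,2,3,4,5,6,7,8}"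
  by auto

lemma ball8: "(\<forall>i\<in>{1..8::nat}. P i) \<longleftrightarrow> P 1 \<and> P 2 \<and> P 3 \<and> P 4 \<and> P 5 \<and> P 6 \<and> P 7 \<and> P 8"
  unfolding set8 by simp

lemma sum8: "(\<Sum>i=1..8::nat. f i) = f 1 + f 2 + f 3 + f 4 + f 5 + f 6 + f 7 + (f 8 :: 'a::comm_monoid_add)"
  by (simp add: numeral_eq_Suc One_nat_def add_ac)

lemma eps_eqI:
  assumes "\<And>i. i \<in> {1..8} \<Longrightarrow> x \<bullet> \<epsilon> i = y \<bullet> \<epsilon> i"
  shows "x = y"
proof -
  have "\<forall>z. x \<bullet> z = y \<bullet> z"
    using assms by (subst (1 2) inner_eps_expand) simp
  then show ?thesis by (metis vector_eq_rdot)
qed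

lemma eps_expand: "x = (\<Sum>i=1..8. (x \<bullet> \<epsilon> i) *\<^sub>R \<epsilon> i)"
  by (rule eps_eqI) (auto simp: inner_sum_left if_distrib cong: if_cong)

definition dual :: "'a::real_inner set \<Rightarrow> 'a set" where
  "dual X = {x. \<forall>y\<in>X. x \<bullet> y \<in> \<int>}"

lemma dual_subspace: "int_mod.subspace (dual X)"
  by (auto simp: dual_def int_mod.subspace_def inner_add_left)

lemma dual_antimono: "X \<subseteq> Y \<Longrightarrow> dual Y \<subseteq> dual X"
  by (auto simp: dual_def)

lemma subset_dual_swap: "X \<subseteq> dual Y \<longleftrightarrow> Y \<subseteq> dual X"
proof -
  have "Y \<subseteq> dual X" if "X \<subseteq> dual Y" for X Y :: "'a set"
    unfolding dual_def
  proof clarify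
    fix x y assume "y \<in> Y" "x \<in> X"
    with that have "x \<bullet> y \<in> \<int>" by (auto simp: dual_def)
    then show "y \<bullet> x \<in> \<int>" by (subst inner_commute)
  qed
  then show ?thesis by blast
qed

text \<open>By the Galois connection \<open>subset_dual_swap\<close>, integrality against a lattice
  need only be tested on generators.\<close>

lemma dual_int_span: "dual (int_span X) = dual X"
proof
  show "dual X \<subseteq> dual (int_span X)"
    unfolding int_span_eq subset_dual_swap[of "dual X"]
    by (intro int_mod.span_minimal dual_subspace) (simp add: subset_dual_swap[of X])
  show "dual (int_span X) \<subseteq> dual X"
    by (rule dual_antimono) (simp add: int_span_eq int_mod.span_superset)
qed

section \<open>\<open>Lambda8\<close> as the lattice of the extended Hamming code\<close>

text \<open>The halved rows of a parity check matrix of the Hamming code underlying \<open>Lambda8\<close>.\<close>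

definition checks :: "(real ^ 8) set" where
  "checks = {(1/2) *\<^sub>R (\<epsilon> 5 + \<epsilon> 6 + \<epsilon> 7 + \<epsilon> 8), (1/2) *\<^sub>R (\<epsilon> 3 + \<epsilon> 4 + \<epsilon> 7 + \<epsilon> 8),
             (1/2) *\<^sub>R (\<epsilon> 2 + \<epsilon> 4 + \<epsilon> 6 + \<epsilon> 8), (1/2) *\<^sub>R (\<epsilon> 1 + \<epsilon> 4 + \<epsilon> 6 + \<epsilon> 7)}"

lemma Lambda8_subspace: "int_mod.subspace Lambda8"
  by (simp add: Lambda8_def int_span_eq)

text \<open>\<open>Lambda8\<close> consists of the integral vectors that reduce mod 2 to codewords:
  pairing with the \<epsilon>_i tests integrality, pairing with the halved check rows tests the four
  parities.\<close>

lemma Lambda8_eq_dual: "Lambda8 = dual (\<epsilon> ` {1..8} \<union> checks)" (is "_ = ?R")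
proof
  show "Lambda8 \<subseteq> ?R"
    unfolding Lambda8_def int_span_eq
    by (intro int_mod.span_minimal dual_subspace)
      (simp add: dual_def checks_def ball8 ball_Un inner_add_left inner_add_right)
next
  show "?R \<subseteq> Lambda8"
  proof
    fix x assume x: "x \<in> ?R"
    then have "\<forall>i\<in>{1..8}. \<exists>k. x \<bullet> \<epsilon> i = of_int k"
      by (auto simp: dual_def elim!: Ints_cases)
    then obtain n where n: "\<And>i. i \<in> {1..8} \<Longrightarrow> x \<bullet> \<epsilon> i = of_int (n i)" by metis
    from x obtain a b c d where
      k: "x \<bullet> (\<epsilon> 5 + \<epsilon> 6 + \<epsilon> 7 + \<epsilon> 8) / 2 = of_int a" "x \<bullet> (\<epsilon> 3 + \<epsilon> 4 + \<epsilon> 7 + \<epsilon> 8) / 2 = of_int b"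
        "x \<bullet> (\<epsilon> 2 + \<epsilon> 4 + \<epsilon> 6 + \<epsilon> 8) / 2 = of_int c" "x \<bullet> (\<epsilon> 1 + \<epsilon> 4 + \<epsilon> 6 + \<epsilon> 7) / 2 = of_int d"
      by (auto simp: dual_def checks_def elim!: Ints_cases)
    let ?G = "{2 *\<^sub>R \<epsilon> 1, 2 *\<^sub>R \<epsilon> 2, 2 *\<^sub>R \<epsilon> 3, \<epsilon> 1 + \<epsilon> 2 + \<epsilon> 3 + \<epsilon> 4, 2 *\<^sub>R \<epsilon> 5,
      \<epsilon> 1 + \<epsilon> 2 + \<epsilon> 5 + \<epsilon> 6, \<epsilon> 1 + \<epsilon> 3 + \<epsilon> 5 + \<epsilon> 7, \<epsilon> 2 + \<epsilon> 4 + \<epsilon> 6 + \<epsilon> 8}"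
    \<comment> \<open>Back substitution: coordinates 8, 7, 6 and 4 determine the coefficients of the
      four codewords. What then remains at 1, 2, 3 and 5 is even by the four checks, and half of it
      is the coefficient of the vector \<open>2 *\<^sub>R \<epsilon> i\<close>.\<close>
    let ?y = "of_int (d - n 4 - n 6 - n 7 + n 8) *\<^sub>R (2 *\<^sub>R \<epsilon> 1)
      + of_int (c - n 4 - n 6) *\<^sub>R (2 *\<^sub>R \<epsilon> 2)
      + of_int (b - n 4 - n 7) *\<^sub>R (2 *\<^sub>R \<epsilon> 3)
      + of_int (n 4 - n 8) *\<^sub>R (\<epsilon> 1 + \<epsilon> 2 + \<epsilon> 3 + \<epsilon> 4)
      + of_int (a - n 6 - n 7) *\<^sub>R (2 *\<^sub>R \<epsilon> 5)
      + of_int (n 6 - n 8) *\<^sub>R (\<epsilon> 1 + \<epsilon> 2 + \<epsilon> 5 + \<epsilon> 6)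
      + of_int (n 7) *\<^sub>R (\<epsilon> 1 + \<epsilon> 3 + \<epsilon> 5 + \<epsilon> 7)
      + of_int (n 8) *\<^sub>R (\<epsilon> 2 + \<epsilon> 4 + \<epsilon> 6 + \<epsilon> 8)"
    have "\<forall>i\<in>{1..8}. x \<bullet> \<epsilon> i = ?y \<bullet> \<epsilon> i"
      using k n[of 1] n[of 2] n[of 3] n[of 4] n[of 5] n[of 6] n[of 7] n[of 8]
      by (simp add: ball8 inner_add_left inner_add_right)
    then have "x = ?y"
      by (intro eps_eqI) blast
    moreover have gen: "of_int k *\<^sub>R g \<in> int_mod.span ?G" if "g \<in> ?G" for k g
      using that by (intro int_mod.span_scale int_mod.span_base)
    have "?y \<in> int_mod.span ?G"
      by (intro int_mod.span_add gen) (simp_all only: insert_iff simp_thms)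
    ultimately show "x \<in> Lambda8"
      by (simp only: Lambda8_def int_span_eq)
  qed
qed

lemma Lambda8_iff:
  "x \<in> Lambda8 \<longleftrightarrow> (\<forall>i\<in>{1..8}. x \<bullet> \<epsilon> i \<in> \<int>) \<and>
    (x \<bullet> \<epsilon> 5 + x \<bullet> \<epsilon> 6 + x \<bullet> \<epsilon> 7 + x \<bullet> \<epsilon> 8) / 2 \<in> \<int> \<and>
    (x \<bullet> \<epsilon> 3 + x \<bullet> \<epsilon> 4 + x \<bullet> \<epsilon> 7 + x \<bullet> \<epsilon> 8) / 2 \<in> \<int> \<and>
    (x \<bullet> \<epsilon> 2 + x \<bullet> \<epsilon> 4 + x \<bullet> \<epsilon> 6 + x \<bullet> \<epsilon> 8) / 2 \<in> \<int> \<and>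
    (x \<bullet> \<epsilon> 1 + x \<bullet> \<epsilon> 4 + x \<bullet> \<epsilon> 6 + x \<bullet> \<epsilon> 7) / 2 \<in> \<int>"
  by (simp add: Lambda8_eq_dual dual_def checks_def ball_Un inner_add_right conj_ac)

lemma two_eps_in_Lambda8: "i \<in> {1..8} \<Longrightarrow> 2 *\<^sub>R \<epsilon> i \<in> Lambda8"
  unfolding Lambda8_iff set8 by auto

text \<open>Self-duality of the code: the rows of the check matrix are themselves codewords.\<close>

lemma checks_in_half_Lambda8: "w \<in> checks \<Longrightarrow> 2 *\<^sub>R w \<in> Lambda8"
  by (auto simp: checks_def Lambda8_iff ball8 inner_add_left)

text \<open>Checked on pairs of generators and spread to the lattice one argument at a time. Halving
  one argument turns evenness into membership in a dual, which is closed under integral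
  combinations.\<close>

lemma Lambda8_inner_even:
  assumes "x \<in> Lambda8" "y \<in> Lambda8"
  shows "x \<bullet> y / 2 \<in> \<int>"
proof -
  let ?G = "{2 *\<^sub>R \<epsilon> 1, 2 *\<^sub>R \<epsilon> 2, 2 *\<^sub>R \<epsilon> 3, \<epsilon> 1 + \<epsilon> 2 + \<epsilon> 3 + \<epsilon> 4, 2 *\<^sub>R \<epsilon> 5,
      \<epsilon> 1 + \<epsilon> 2 + \<epsilon> 5 + \<epsilon> 6, \<epsilon> 1 + \<epsilon> 3 + \<epsilon> 5 + \<epsilon> 7, \<epsilon> 2 + \<epsilon> 4 + \<epsilon> 6 + \<epsilon> 8}"
  let ?H = "(*\<^sub>R) (1/2) ` ?G"
  have "?G \<subseteq> dual ?H"
    by (simp add: dual_def inner_add_left inner_add_right)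
  then have "Lambda8 \<subseteq> dual ?H"
    unfolding Lambda8_def int_span_eq by (intro int_mod.span_minimal dual_subspace)
  then have "?G \<subseteq> dual ((*\<^sub>R) (1/2) ` Lambda8)"
    by (force simp: dual_def inner_commute)
  then have "Lambda8 \<subseteq> dual ((*\<^sub>R) (1/2) ` Lambda8)"
    by (subst Lambda8_def) (unfold int_span_eq, intro int_mod.span_minimal dual_subspace)
  with assms show ?thesis by (force simp: dual_def)
qed

text \<open>The generators all have norm 4, and in the norm of a sum the cross term 2(x.y) is
  divisible by 4 because x.y is even.\<close>

lemma Lambda8_norm:
  assumes "x \<in> Lambda8"
  shows "x \<bullet> x / 4 \<in> \<int>"
proof -
  have "int_mod.subspace {x \<in> Lambda8. x \<bullet> x / 4 \<in> \<int>}"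
    unfolding int_mod.subspace_def
  proof (intro conjI ballI allI)
    fix x y assume *: "x \<in> {x \<in> Lambda8. x \<bullet> x / 4 \<in> \<int>}" "y \<in> {x \<in> Lambda8. x \<bullet> x / 4 \<in> \<int>}"
    then have "x \<bullet> x / 4 + y \<bullet> y / 4 + x \<bullet> y / 2 \<in> \<int>"
      using Lambda8_inner_even by auto
    moreover have "x \<bullet> x / 4 + y \<bullet> y / 4 + x \<bullet> y / 2 = (x + y) \<bullet> (x + y) / 4"
      by (simp add: inner_add_left inner_add_right inner_commute)
    ultimately show "x + y \<in> {x \<in> Lambda8. x \<bullet> x / 4 \<in> \<int>}"
      using * int_mod.subspace_add[OF Lambda8_subspace] by auto
  next
    fix c :: int and x assume *: "x \<in> {x \<in> Lambda8. x \<bullet> x / 4 \<in> \<int>}"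
    then have "of_int (c * c) * (x \<bullet> x / 4) \<in> \<int>"
      by (intro Ints_mult) auto
    then show "of_int c *\<^sub>R x \<in> {x \<in> Lambda8. x \<bullet> x / 4 \<in> \<int>}"
      using * int_mod.subspace_scale[OF Lambda8_subspace, of x c] by (simp add: mult_ac)
  qed (simp add: int_mod.subspace_0[OF Lambda8_subspace])
  then have "Lambda8 \<subseteq> {x \<in> Lambda8. x \<bullet> x / 4 \<in> \<int>}"
    by (subst Lambda8_def, unfold int_span_eq, intro int_mod.span_minimal)
      (simp_all add: Lambda8_iff ball8 inner_add_left inner_add_right)
  with assms show ?thesis by blast
qed

text \<open>This is unimodularity of \<open>Lambda8\<close> scaled by 1/sqrt 2. The vectors that cut
  out \<open>Lambda8\<close> have their doubles in \<open>Lambda8\<close>, so a dual x satisfies all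
  the membership conditions after doubling.\<close>

lemma dual_Lambda8: "dual Lambda8 = {x. 2 *\<^sub>R x \<in> Lambda8}"
proof (intro set_eqI iffI CollectI)
  fix x assume x: "x \<in> dual Lambda8"
  then have "x \<bullet> 2 *\<^sub>R y \<in> \<int>" if "y \<in> \<epsilon> ` {1..8} \<union> checks" for y
    using that two_eps_in_Lambda8 checks_in_half_Lambda8 by (fastforce simp: dual_def)
  then show "2 *\<^sub>R x \<in> Lambda8"
    by (simp add: Lambda8_eq_dual dual_def)
next
  fix x assume "x \<in> {x. 2 *\<^sub>R x \<in> Lambda8}"
  then show "x \<in> dual Lambda8"
    using Lambda8_inner_even[of "2 *\<^sub>R x"] by (simp add: dual_def)
qed

subsection \<open>Reflections\<close>

text \<open>There is no division by \<open>r \<bullet> r\<close>, so the formula is a reflection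
  only for unit vectors r.\<close>

definition reflection :: "'a::real_inner \<Rightarrow> 'a \<Rightarrow> 'a" where
  "reflection r x = x - (2 * (x \<bullet> r)) *\<^sub>R r"

lemma reflection_orthogonal:
  assumes "r \<bullet> r = 1"
  shows "orthogonal_transformation (reflection r)"
  unfolding orthogonal_transformation_def
proof (intro conjI allI)
  show "linear (reflection r)"
    by (rule linearI) (simp_all add: reflection_def inner_add_left algebra_simps)
  show "reflection r v \<bullet> reflection r w = v \<bullet> w" for v w
    using assms by (simp add: reflection_def inner_diff_left inner_diff_right inner_commute algebra_simps)
qed

lemma reflection_involutive: "r \<bullet> r = 1 \<Longrightarrow> reflection r (reflection r x) = x"
  by (simp add: reflection_def inner_diff_left algebra_simps)

text \<open>The shortest nonzero vectors of half of \<open>Lambda8\<close>: the roots of E_8 scaled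
  by 1/sqrt 2.\<close>

definition unit_root :: "real ^ 8 \<Rightarrow> bool" where
  "unit_root r \<longleftrightarrow> r \<bullet> r = 1 \<and> 2 *\<^sub>R r \<in> Lambda8"

text \<open>What is subtracted from x is the multiple x.r of 2r, where x.r is an integer because r
  is dual to \<open>Lambda8\<close>. Equality then follows from involutivity.\<close>

lemma reflection_Lambda8:
  assumes "unit_root r"
  shows "reflection r ` Lambda8 = Lambda8"
proof -
  have sub: "reflection r ` Lambda8 \<subseteq> Lambda8"
  proof clarify
    fix x assume x: "x \<in> Lambda8"
    have "r \<in> dual Lambda8" using assms by (simp add: unit_root_def dual_Lambda8)
    then obtain k where k: "x \<bullet> r = of_int k"
      using x by (auto simp: dual_def inner_commute elim!: Ints_cases)
    have "x - of_int k *\<^sub>R (2 *\<^sub>R r) \<in> Lambda8"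
      using assms x by (intro int_mod.subspace_diff[OF Lambda8_subspace]
          int_mod.subspace_scale[OF Lambda8_subspace]) (auto simp: unit_root_def)
    then show "reflection r x \<in> Lambda8"
      by (simp add: reflection_def k mult.commute)
  qed
  moreover have "x \<in> reflection r ` Lambda8" if "x \<in> Lambda8" for x
    using sub that assms reflection_involutive[of r x] unfolding unit_root_def by (metis imageI subsetD)
  ultimately show ?thesis by blast
qed

text \<open>An integral lattice as an additive group; discreteness and full rank come from its
  position between \<open>Lambda8\<close> and \<open>dual Lambda8\<close>.\<close>

definition overlattice :: "(real ^ 8) set \<Rightarrow> bool" where
  "overlattice M \<longleftrightarrow> int_mod.subspace M \<and> Lambda8 \<subseteq> M \<and> M \<subseteq> dual M"

text \<open>Stronger than isometry: stabilizing \<open>Lambda8\<close> keeps the image an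
  overlattice, so that moves can be iterated.\<close>

definition equivalent :: "(real ^ 8) set \<Rightarrow> (real ^ 8) set \<Rightarrow> bool" where
  "equivalent M N \<longleftrightarrow> (\<exists>g. orthogonal_transformation g \<and> g ` Lambda8 = Lambda8 \<and> g ` M = N)"

lemma equivalent_refl: "equivalent M M"
  unfolding equivalent_def
  by (rule exI[of _ id]) (simp add: orthogonal_transformation_id[unfolded id_def] id_def)

lemma equivalent_trans:
  assumes "equivalent M N" "equivalent N P"
  shows "equivalent M P"
proof -
  obtain f g where "orthogonal_transformation f" "f ` Lambda8 = Lambda8" "f ` M = N"
    "orthogonal_transformation g" "g ` Lambda8 = Lambda8" "g ` N = P"
    using assms by (auto simp: equivalent_def)
  then show ?thesis
    unfolding equivalent_def
    by (intro exI[of _ "g \<circ> f"]) (simp add: orthogonal_transformation_compose image_comp[symmetric] del: o_apply)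
qed

lemma dual_image:
  assumes "orthogonal_transformation (g :: 'a::euclidean_space \<Rightarrow> 'a)"
  shows "dual (g ` M) = g ` dual M"
proof
  show "g ` dual M \<subseteq> dual (g ` M)"
    using assms by (auto simp: dual_def orthogonal_transformation_def)
  show "dual (g ` M) \<subseteq> g ` dual M"
  proof
    fix y assume y: "y \<in> dual (g ` M)"
    obtain x where x: "y = g x"
      using orthogonal_transformation_surj[OF assms] by blast
    have "x \<in> dual M"
      using y assms by (auto simp: dual_def x orthogonal_transformation_def)
    then show "y \<in> g ` dual M" using x by blast
  qed
qed

lemma subspace_image:
  assumes "linear g" "int_mod.subspace M"
  shows "int_mod.subspace (g ` M)"
  unfolding int_mod.subspace_def
proof (intro conjI ballI allI)
  show "0 \<in> g ` M"
    using linear_0[OF assms(1)] int_mod.subspace_0[OF assms(2)] by force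
  show "x + y \<in> g ` M" if "x \<in> g ` M" "y \<in> g ` M" for x y
    using that int_mod.subspace_add[OF assms(2)] linear_add[OF assms(1)] by (metis (no_types) imageE imageI)
  show "of_int c *\<^sub>R x \<in> g ` M" if "x \<in> g ` M" for c x
    using that int_mod.subspace_scale[OF assms(2)] linear_scale[OF assms(1)] by (metis (no_types) imageE imageI)
qed

lemma overlattice_image:
  assumes "orthogonal_transformation g" "g ` Lambda8 = Lambda8" "overlattice M"
  shows "overlattice (g ` M)"
proof -
  have "g ` M \<subseteq> dual (g ` M)"
    using assms by (simp add: dual_image overlattice_def image_mono)
  moreover have "Lambda8 \<subseteq> g ` M"
    using assms by (metis image_mono overlattice_def)
  ultimately show ?thesis
    using assms subspace_image[of g M] by (simp add: overlattice_def orthogonal_transformation_linear)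
qed

lemma overlattice_subset_dual: "overlattice M \<Longrightarrow> M \<subseteq> dual Lambda8"
  unfolding overlattice_def using dual_antimono by blast

lemma overlattice_add: "overlattice M \<Longrightarrow> x \<in> M \<Longrightarrow> y \<in> M \<Longrightarrow> x + y \<in> M"
  and overlattice_diff: "overlattice M \<Longrightarrow> x \<in> M \<Longrightarrow> y \<in> M \<Longrightarrow> x - y \<in> M"
  and overlattice_inner: "overlattice M \<Longrightarrow> x \<in> M \<Longrightarrow> y \<in> M \<Longrightarrow> x \<bullet> y \<in> \<int>"
  by (auto simp: overlattice_def dual_def intro: int_mod.subspace_add int_mod.subspace_diff)

text \<open>The bridge from real norms to parity: for an integral norm, a half outside \<int> means
  that the norm is odd.\<close>

lemma half_int_iff: "real_of_int k / 2 \<in> \<int> \<longleftrightarrow> even k"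
proof
  assume "real_of_int k / 2 \<in> \<int>"
  then obtain z where "real_of_int k / 2 = of_int z" by (elim Ints_cases)
  then have "real_of_int k = of_int (2 * z)" by simp
  then have "k = 2 * z" unfolding of_int_eq_iff .
  then show "even k" by simp
qed auto

lemma Lambda8_int_iff:
  assumes "\<And>i. i \<in> {1..8} \<Longrightarrow> x \<bullet> \<epsilon> i = real_of_int (n i)"
  shows "x \<in> Lambda8 \<longleftrightarrow> even (n 5 + n 6 + n 7 + n 8) \<and> even (n 3 + n 4 + n 7 + n 8) \<and>
    even (n 2 + n 4 + n 6 + n 8) \<and> even (n 1 + n 4 + n 6 + n 7)"
proof -
  have "\<forall>i\<in>{1..8}. x \<bullet> \<epsilon> i \<in> \<int>"
    using assms by auto
  then show ?thesis
    unfolding Lambda8_iff half_int_iff[symmetric] of_int_add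
    using assms by simp
qed

lemma reflection_fixes: "x \<bullet> r = 0 \<Longrightarrow> reflection r x = x"
  by (simp add: reflection_def)

lemma reflection_equivalent:
  assumes "unit_root r" "overlattice M"
  shows "equivalent M (reflection r ` M)" "overlattice (reflection r ` M)"
  using assms reflection_orthogonal[of r] reflection_Lambda8[of r] overlattice_image[of "reflection r" M]
  by (auto simp: equivalent_def unit_root_def)

text \<open>The product of two reflections sends $\varepsilon_i$ to $-\varepsilon_j$.\<close>

lemma move_eps:
  assumes M: "overlattice M" "\<epsilon> i \<in> M" and ijkl: "distinct [i, j, k, l]" "{i, j, k, l} \<subseteq> {1..8}"
    and block: "\<epsilon> i + \<epsilon> j + \<epsilon> k + \<epsilon> l \<in> Lambda8"
  obtains M' where "equivalent M M'" "overlattice M'" "\<epsilon> j \<in> M'"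
    "\<And>m. m \<in> {1..8} - {i, j, k, l} \<Longrightarrow> \<epsilon> m \<in> M \<Longrightarrow> \<epsilon> m \<in> M'"
proof -
  \<comment> \<open>Half a codeword of weight 4 is a unit root, and subtracting \<epsilon>_k and
    \<epsilon>_l flips two signs without leaving half of \<open>Lambda8\<close>. The roots r and s
    are orthogonal and both pair with \<epsilon>_i to 1/2, so the two reflections together subtract
    r + s. They fix every \<epsilon>_m outside the block.\<close>
  define r where "r = (1/2) *\<^sub>R (\<epsilon> i + \<epsilon> j + \<epsilon> k + \<epsilon> l)"
  define s where "s = (1/2) *\<^sub>R (\<epsilon> i + \<epsilon> j - \<epsilon> k - \<epsilon> l)"
  have i: "i \<in> {1..8}" "j \<in> {1..8}" "k \<in> {1..8}" "l \<in> {1..8}"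
    using ijkl by auto
  note [simp] = inner_add_left inner_add_right inner_diff_left inner_diff_right
  have "r \<bullet> r = 1" "s \<bullet> s = 1" "\<epsilon> i \<bullet> r = 1/2" "\<epsilon> i \<bullet> s = 1/2" "r \<bullet> s = 0"
    using i ijkl(1) by (simp_all add: r_def s_def)
  note r = this
  have "2 *\<^sub>R r \<in> Lambda8"
    using block by (simp add: r_def)
  moreover have "2 *\<^sub>R s = (\<epsilon> i + \<epsilon> j + \<epsilon> k + \<epsilon> l) - 2 *\<^sub>R \<epsilon> k - 2 *\<^sub>R \<epsilon> l"
    by (simp add: s_def scaleR_2)
  then have "2 *\<^sub>R s \<in> Lambda8"
    using int_mod.subspace_diff[OF Lambda8_subspace] block two_eps_in_Lambda8 i by metis
  ultimately have roots: "unit_root r" "unit_root s"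
    by (simp_all add: unit_root_def r)
  have "reflection s (reflection r (\<epsilon> i)) = \<epsilon> i - (r + s)"
    by (simp add: reflection_def r)
  moreover have "r + s = \<epsilon> i + \<epsilon> j"
    by (simp add: r_def s_def vec_eq_iff field_simps)
  ultimately have "reflection s (reflection r (\<epsilon> i)) = - \<epsilon> j"
    by simp
  then have img: "- \<epsilon> j \<in> reflection s ` reflection r ` M"
    using imageI[OF imageI[OF M(2)], of "reflection s" "reflection r"] by simp
  define M' where "M' = reflection s ` reflection r ` M"
  have M': "overlattice M'" "equivalent M M'"
    unfolding M'_def using reflection_equivalent[OF roots(1) M(1)] reflection_equivalent(1)[OF roots(2)]
      reflection_equivalent(2)[OF roots(2)] by (auto intro: equivalent_trans)
  show thesis
  proof
    show "\<epsilon> j \<in> M'"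
      using img M'(1) int_mod.subspace_neg[of M' "- \<epsilon> j"] by (simp add: M'_def overlattice_def)
    fix m assume m: "m \<in> {1..8} - {i, j, k, l}" "\<epsilon> m \<in> M"
    then have "reflection s (reflection r (\<epsilon> m)) = \<epsilon> m"
      using i by (simp add: reflection_fixes r_def s_def)
    then show "\<epsilon> m \<in> M'"
      using m(2) unfolding M'_def by (metis imageI)
  qed (use M' in auto)
qed

text \<open>The columns of the check matrix are the eight vectors of odd weight in F_2^4. The four
  rows sum to the all-ones word, so an integral vector of odd norm has a syndrome of odd weight;
  this is column i for some i, and subtracting \<epsilon>_i corrects it.\<close>

lemma odd_integral_cong_eps:
  assumes int: "\<And>i. i \<in> {1..8} \<Longrightarrow> x \<bullet> \<epsilon> i \<in> \<int>" and odd: "x \<bullet> x / 2 \<notin> \<int>"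
  shows "\<exists>i\<in>{1..8}. x - \<epsilon> i \<in> Lambda8"
proof -
  have "\<forall>i\<in>{1..8}. \<exists>k. x \<bullet> \<epsilon> i = of_int k"
    using int by (meson Ints_cases)
  then obtain n where n: "\<And>i. i \<in> {1..8} \<Longrightarrow> x \<bullet> \<epsilon> i = of_int (n i)" by metis
  have "x \<bullet> x = of_int (\<Sum>i=1..8. n i * n i)"
    by (subst inner_eps_expand) (simp add: n)
  then have odd: "odd (\<Sum>i=1..8. n i * n i)"
    using odd half_int_iff by metis
  have *: "x - \<epsilon> i \<in> Lambda8 \<longleftrightarrow> (let m = n(i := n i - 1) in
    even (m 5 + m 6 + m 7 + m 8) \<and> even (m 3 + m 4 + m 7 + m 8) \<and>
    even (m 2 + m 4 + m 6 + m 8) \<and> even (m 1 + m 4 + m 6 + m 7))" if "i \<in> {1..8}" for i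
    unfolding Let_def using that by (intro Lambda8_int_iff) (simp add: inner_diff_left n)
  \<comment> \<open>Case split over the sixteen syndromes: those of even weight contradict the odd
    norm, the others each determine i.\<close>
  have "\<exists>i\<in>{1..8}. (let m = n(i := n i - 1) in
    even (m 5 + m 6 + m 7 + m 8) \<and> even (m 3 + m 4 + m 7 + m 8) \<and>
    even (m 2 + m 4 + m 6 + m 8) \<and> even (m 1 + m 4 + m 6 + m 7))"
    using odd unfolding sum8 set8 Let_def
    apply simp
    apply (cases "even (n 5 + n 6 + n 7 + n 8)"; cases "even (n 3 + n 4 + n 7 + n 8)";
        cases "even (n 2 + n 4 + n 6 + n 8)"; cases "even (n 1 + n 4 + n 6 + n 7)")
                   apply simp_all
           apply argo+
    done
  with * show ?thesis by blast
qed

lemma adjoin_subspace: "int_mod.subspace (adjoin L X)"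
  by (simp add: adjoin_def int_span_eq)

lemma adjoin_superset: "L \<union> X \<subseteq> adjoin L X"
  by (simp add: adjoin_def int_span_eq int_mod.span_superset)

lemma adjoin_least: "L \<union> X \<subseteq> S \<Longrightarrow> int_mod.subspace S \<Longrightarrow> adjoin L X \<subseteq> S"
  by (simp add: adjoin_def int_span_eq int_mod.span_minimal)

lemma odd_square:
  assumes "odd (n :: int)"
  shows "\<exists>k. n * n = 8 * k + 1"
proof -
  obtain m where m: "n = 2 * m + 1"
    using assms by (elim oddE)
  obtain k where "m * (m + 1) = 2 * k"
    by (metis even_mult_iff even_plus_one_iff evenE)
  then have "n * n = 8 * k + 1"
    by (simp add: m algebra_simps)
  then show ?thesis ..
qed

subsection \<open>Lattices containing a vector of odd norm\<close>

text \<open>The vector \<open>s\<close> is half the sum of the $\varepsilon_i$ over the $i$ at which $x$ is half-integral;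
  flipping one sign if necessary makes $x\cdot s$ half-integral. The number of such $i$ is divisible
  by 4, as norms in \<open>Lambda8\<close> are, and it is not 8, because squares of odd integers are 1 modulo 8.\<close>

lemma integral_shift:
  assumes M: "overlattice M" "x \<in> M" "x \<bullet> x / 2 \<notin> \<int>" and F: "F \<subseteq> {1..8}" "\<epsilon> ` F \<subseteq> M"
  obtains s k where "\<And>i. i \<in> {1..8} \<Longrightarrow> (x - of_int k *\<^sub>R s) \<bullet> \<epsilon> i \<in> \<int>"
    "k = 0 \<or> unit_root s \<and> 2 * (x \<bullet> s) = of_int k" "\<And>i. i \<in> F \<Longrightarrow> \<epsilon> i \<bullet> s = 0"
proof -
  have x2: "2 *\<^sub>R x \<in> Lambda8"
    using overlattice_subset_dual[OF M(1)] M(2) by (auto simp: dual_Lambda8)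
  then have "\<forall>i\<in>{1..8}. \<exists>k. 2 *\<^sub>R x \<bullet> \<epsilon> i = of_int k"
    unfolding Lambda8_iff by (meson Ints_cases)
  then obtain n where n': "\<And>i. i \<in> {1..8} \<Longrightarrow> 2 *\<^sub>R x \<bullet> \<epsilon> i = of_int (n i)" by metis
  then have n: "\<And>i. i \<in> {1..8} \<Longrightarrow> x \<bullet> \<epsilon> i = of_int (n i) / 2"
    by (simp add: field_simps)
  define C where "C = {i \<in> {1..8}. odd (n i)}"
  define r where "r = (1/2) *\<^sub>R (\<Sum>i\<in>C. \<epsilon> i)"
  have finC: "finite C" and subC: "C \<subseteq> {1..8}"
    by (auto simp: C_def)
  have r_eps: "r \<bullet> \<epsilon> i = (if i \<in> C then 1/2 else 0)" if "i \<in> {1..8}" for i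
  proof -
    have "(\<Sum>j\<in>C. \<epsilon> j) \<bullet> \<epsilon> i = (\<Sum>j\<in>C. if j = i then 1 else 0)"
      using that subC by (auto simp: inner_sum_left intro!: sum.cong)
    then show ?thesis using finC by (simp add: r_def)
  qed
  have "r \<bullet> r = (\<Sum>i=1..8. if i \<in> C then 1/4 else 0)"
    by (subst inner_eps_expand) (auto intro!: sum.cong simp: r_eps)
  also have "\<dots> = (\<Sum>i\<in>C. 1/4)"
    using subC by (simp add: sum.If_cases Int_absorb1)
  finally have rr: "r \<bullet> r = card C / 4"
    by simp
  \<comment> \<open>All coordinates of the difference are even, so it lies in
    \<open>Lambda8\<close>. Hence 2r, the indicator vector of \<open>C\<close>, lies there too, and
    its norm \<open>card C\<close> is a multiple of 4.\<close>
  have "2 *\<^sub>R x - 2 *\<^sub>R r \<in> Lambda8"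
  proof (subst Lambda8_int_iff)
    show "(2 *\<^sub>R x - 2 *\<^sub>R r) \<bullet> \<epsilon> i = real_of_int (n i - (if i \<in> C then 1 else 0))" if "i \<in> {1..8}" for i
      using n[OF that] r_eps[OF that] by (simp add: inner_diff_left)
  qed (auto simp: C_def)
  then have r2: "2 *\<^sub>R r \<in> Lambda8"
    using int_mod.subspace_diff[OF Lambda8_subspace x2] by fastforce
  have "card C / 4 \<in> \<int>"
    using Lambda8_norm[OF r2] by (simp add: rr)
  then obtain q where "real (card C) / 4 = of_int q"
    by (elim Ints_cases)
  then have "real_of_int (int (card C)) = of_int (4 * q)"
    by simp
  then have q: "int (card C) = 4 * q"
    unfolding of_int_eq_iff .
  moreover have "card C \<le> 8"
    using card_mono[OF _ subC] by simp
  ultimately have "q = 0 \<or> q = 1 \<or> q = 2"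
    by linarith
  then consider "card C = 0" | "card C = 4" | "card C = 8"
    using q by linarith
  then show thesis
  proof cases
    case 1
    then have "even (n i)" if "i \<in> {1..8}" for i
      using finC that by (auto simp: C_def)
    then have "x \<bullet> \<epsilon> i \<in> \<int>" if "i \<in> {1..8}" for i
      using that by (simp only: n half_int_iff)
    then show thesis
      by (intro that[of 0 0]) auto
  next
    case 3
    then have "{1..8} \<subseteq> C"
      using subC card_subset_eq[of "{1..8}" C] by simp
    then have "odd (n i)" if "i \<in> {1..8}" for i
      using that unfolding C_def by blast
    then have "\<forall>i\<in>{1..8}. \<exists>k. n i * n i = 8 * k + 1"
      using odd_square by blast
    then obtain k where k: "\<And>i. i \<in> {1..8} \<Longrightarrow> n i * n i = 8 * k i + 1"
      by metis
    have "x \<bullet> x = (\<Sum>i=1..8. of_int (n i * n i) / 4)"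
      by (subst inner_eps_expand) (simp add: n)
    also have "\<dots> = (\<Sum>i=1..8. of_int (8 * k i + 1) / 4)"
      by (intro sum.cong) (simp_all only: k)
    also have "\<dots> / 2 = of_int ((\<Sum>i=1..8. k i) + 1)"
      by (simp add: add_divide_distrib sum.distrib sum_divide_distrib)
    finally show thesis
      using M(3) by (metis Ints_of_int)
  next
    case 2
    then obtain j where j: "j \<in> C"
      by fastforce
    have j8: "j \<in> {1..8}"
      using j subC by blast
    \<comment> \<open>Flipping the sign at j changes 2(x.r) by n j, which is odd; hence one of r and
      r' pairs with x to half of an odd integer.\<close>
    define r' where "r' = r - \<epsilon> j"
    have roots: "unit_root r" "unit_root r'"
    proof -
      show "unit_root r"
        using rr r2 2 by (simp add: unit_root_def)
      have "2 *\<^sub>R r' \<in> Lambda8"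
        using int_mod.subspace_diff[OF Lambda8_subspace r2 two_eps_in_Lambda8[OF j8]]
        by (simp add: r'_def scaleR_diff_right)
      then show "unit_root r'"
        using rr 2 r_eps[OF j8] j j8
        by (simp add: unit_root_def r'_def inner_diff_left inner_diff_right inner_commute)
    qed
    have "r \<in> dual Lambda8"
      using r2 by (simp add: dual_Lambda8)
    then have "2 * (x \<bullet> r) \<in> \<int>"
      using x2 by (fastforce simp: dual_def inner_commute)
    then obtain a where a: "2 * (x \<bullet> r) = of_int a"
      by (elim Ints_cases)
    have a': "2 * (x \<bullet> r') = of_int (a - n j)"
      using a n[OF j8] by (simp add: r'_def inner_diff_right)
    obtain s k where sk: "unit_root s" "2 * (x \<bullet> s) = of_int k" "odd k" "s = r \<or> s = r'"
    proof (cases "even a")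
      case True
      moreover have "odd (n j)"
        using j by (simp add: C_def)
      ultimately show thesis
        using that[OF roots(2) a'] by simp
    next
      case False
      then show thesis
        using that[OF roots(1) a] by simp
    qed
    \<comment> \<open>The coordinates of 2s, odd exactly on \<open>C\<close>, just like n. As k is
      odd, \<open>n i - k * m i\<close> is always even.\<close>
    define m :: "nat \<Rightarrow> int" where "m i = (if i \<in> C then (if i = j \<and> s = r' then - 1 else 1) else 0)" for i
    have "r \<noteq> r'"
      using eps_inner_eps[OF j8 j8] by (auto simp: r'_def)
    then have m: "s \<bullet> \<epsilon> i = of_int (m i) / 2" if "i \<in> {1..8}" for i
      using sk(4) r_eps[OF that] that j j8 by (auto simp: m_def r'_def inner_diff_left)
    have "(x - of_int k *\<^sub>R s) \<bullet> \<epsilon> i = of_int (n i - k * m i) / 2" if "i \<in> {1..8}" for i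
      using that by (simp add: inner_diff_left n m field_simps)
    moreover have "even (n i - k * m i)" if "i \<in> {1..8}" for i
      using that sk(3) by (auto simp: m_def C_def)
    ultimately have "(x - of_int k *\<^sub>R s) \<bullet> \<epsilon> i \<in> \<int>" if "i \<in> {1..8}" for i
      using that by (simp only: half_int_iff)
    \<comment> \<open>Both x and \<epsilon>_i lie in the integral lattice M, so x is integral at i
      and i is outside the support of s.\<close>
    moreover have "\<epsilon> i \<bullet> s = 0" if "i \<in> F" for i
    proof -
      have "x \<bullet> \<epsilon> i \<in> \<int>" "i \<in> {1..8}"
        using that M F overlattice_inner by auto
      then have "even (n i)"
        using n half_int_iff by metis
      then have "i \<notin> C"
        by (simp add: C_def)
      then show ?thesis
        using m[of i] \<open>i \<in> {1..8}\<close> by (simp add: m_def inner_commute)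
    qed
    ultimately show thesis
      using sk that by blast
  qed
qed

text \<open>A reflection makes x integral, after which it is congruent to some \<epsilon>_i modulo
  \<open>Lambda8\<close>. The reflection fixes the \<epsilon>_f with f in F, so it cannot move x
  into the lattice generated by them, and \<epsilon>_i is genuinely new.\<close>

lemma new_eps:
  assumes M: "overlattice M" "x \<in> M" "x \<bullet> x / 2 \<notin> \<int>" and F: "F \<subseteq> {1..8}" "\<epsilon> ` F \<subseteq> M"
    and x: "x \<notin> adjoin Lambda8 (\<epsilon> ` F)"
  obtains M' i where "equivalent M M'" "overlattice M'" "\<epsilon> ` F \<subseteq> M'"
    "i \<in> {1..8}" "\<epsilon> i \<in> M'" "\<epsilon> i \<notin> adjoin Lambda8 (\<epsilon> ` F)"
proof -
  let ?K = "adjoin Lambda8 (\<epsilon> ` F)"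
  obtain s k where int: "\<And>i. i \<in> {1..8} \<Longrightarrow> (x - of_int k *\<^sub>R s) \<bullet> \<epsilon> i \<in> \<int>"
    and k: "k = 0 \<or> unit_root s \<and> 2 * (x \<bullet> s) = of_int k" and s: "\<And>i. i \<in> F \<Longrightarrow> \<epsilon> i \<bullet> s = 0"
    using integral_shift[OF M F] by metis
  define y where "y = x - of_int k *\<^sub>R s"
  obtain M' where M': "equivalent M M'" "overlattice M'" "\<epsilon> ` F \<subseteq> M'" "y \<in> M'"
    and y: "y \<bullet> y = x \<bullet> x" "y \<notin> ?K"
  proof (cases "k = 0")
    case True
    then show thesis
      using that[of M] M F x equivalent_refl by (simp add: y_def)
  next
    case False
    then have rs: "unit_root s" and ks: "2 * (x \<bullet> s) = of_int k"
      using k by auto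
    have yx: "y = reflection s x"
      by (simp add: y_def reflection_def ks)
    have s1: "s \<bullet> s = 1"
      using rs by (simp add: unit_root_def)
    have lin: "linear (reflection s)"
      using reflection_orthogonal[OF s1] orthogonal_transformation_linear by blast
    have fix_eps: "reflection s (\<epsilon> i) = \<epsilon> i" if "i \<in> F" for i
      using s[OF that] by (simp add: reflection_fixes)
    have "\<epsilon> i \<in> reflection s ` M" if "i \<in> F" for i
      using imageI[of "\<epsilon> i" M "reflection s"] F(2) fix_eps[OF that] that by auto
    then have F': "\<epsilon> ` F \<subseteq> reflection s ` M"
      by blast
    \<comment> \<open>The image is a subgroup containing all generators of \<open>?K\<close>. By
      involutivity, y in \<open>?K\<close> would therefore force x in \<open>?K\<close>.\<close>
    have K: "?K \<subseteq> reflection s ` ?K"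
    proof (rule adjoin_least)
      have "Lambda8 \<subseteq> reflection s ` ?K"
        using reflection_Lambda8[OF rs] adjoin_superset[of Lambda8 "\<epsilon> ` F"] by blast
      moreover have "\<epsilon> i \<in> reflection s ` ?K" if "i \<in> F" for i
        using imageI[of "\<epsilon> i" ?K "reflection s"] adjoin_superset[of Lambda8 "\<epsilon> ` F"] fix_eps[OF that] that
        by auto
      ultimately show "Lambda8 \<union> \<epsilon> ` F \<subseteq> reflection s ` ?K"
        by blast
    qed (rule subspace_image[OF lin adjoin_subspace])
    have "y \<notin> ?K"
    proof
      assume "y \<in> ?K"
      with K have "y \<in> reflection s ` ?K"
        by (rule subsetD)
      then obtain z where z: "y = reflection s z" "z \<in> ?K"
        by (rule imageE)
      have "x = reflection s y"
        unfolding yx reflection_involutive[OF s1] ..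
      also have "\<dots> = z"
        unfolding z(1) reflection_involutive[OF s1] ..
      finally show False
        using x z(2) by simp
    qed
    moreover have "y \<bullet> y = x \<bullet> x"
      using reflection_orthogonal[OF s1] by (simp add: yx orthogonal_transformation_def)
    ultimately show thesis
      using reflection_equivalent[OF rs M(1)] M(2) F'
      by (intro that[of "reflection s ` M"]) (unfold yx, blast+)
  qed
  have "(y - of_int 0 *\<^sub>R s) \<bullet> \<epsilon> i \<in> \<int>" if "i \<in> {1..8}" for i
    using int[OF that] by (simp add: y_def)
  then obtain i where i: "i \<in> {1..8}" "y - \<epsilon> i \<in> Lambda8"
    using odd_integral_cong_eps[of y] y M(3) by auto
  have "y - (y - \<epsilon> i) \<in> M'"
    by (rule overlattice_diff) (use M'(2,4) i(2) in \<open>auto simp: overlattice_def\<close>)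
  moreover have "\<epsilon> i \<notin> ?K"
  proof
    assume "\<epsilon> i \<in> ?K"
    then have "(y - \<epsilon> i) + \<epsilon> i \<in> ?K"
      using i(2) adjoin_superset[of Lambda8 "\<epsilon> ` F"] by (intro int_mod.subspace_add[OF adjoin_subspace]) auto
    with y show False by simp
  qed
  ultimately show thesis
    using that M' i(1) by simp
qed

text \<open>\<open>new_eps\<close> needs a vector of odd norm. If a vector outside the current
  sublattice has even norm, adding \<epsilon>_f makes the norm odd and stays outside.\<close>

lemma next_eps:
  assumes M: "overlattice M" and F: "F \<subseteq> {1..8}" "f \<in> F" "\<epsilon> ` F \<subseteq> M"
    and neq: "M \<noteq> adjoin Lambda8 (\<epsilon> ` F)"
  obtains M' i where "equivalent M M'" "overlattice M'" "\<epsilon> ` F \<subseteq> M'"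
    "i \<in> {1..8}" "\<epsilon> i \<in> M'" "\<epsilon> i \<notin> adjoin Lambda8 (\<epsilon> ` F)"
proof -
  let ?K = "adjoin Lambda8 (\<epsilon> ` F)"
  have "?K \<subseteq> M"
    using M F by (intro adjoin_least) (auto simp: overlattice_def)
  then obtain y where y: "y \<in> M" "y \<notin> ?K"
    using neq by blast
  have f: "\<epsilon> f \<in> M" "\<epsilon> f \<in> ?K" "\<epsilon> f \<bullet> \<epsilon> f = 1"
    using F adjoin_superset[of Lambda8 "\<epsilon> ` F"] by auto
  obtain x where x: "x \<in> M" "x \<notin> ?K" "x \<bullet> x / 2 \<notin> \<int>"
  proof (cases "y \<bullet> y / 2 \<in> \<int>")
    case True
    have "y + \<epsilon> f \<notin> ?K"
    proof
      assume "y + \<epsilon> f \<in> ?K"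
      then have "y + \<epsilon> f - \<epsilon> f \<in> ?K"
        using f by (intro int_mod.subspace_diff[OF adjoin_subspace])
      with y show False by simp
    qed
    moreover have "(y + \<epsilon> f) \<bullet> (y + \<epsilon> f) / 2 \<notin> \<int>"
    proof
      assume "(y + \<epsilon> f) \<bullet> (y + \<epsilon> f) / 2 \<in> \<int>"
      then have "(y + \<epsilon> f) \<bullet> (y + \<epsilon> f) / 2 - y \<bullet> y / 2 - y \<bullet> \<epsilon> f \<in> \<int>"
        using True overlattice_inner[OF M y(1) f(1)] by (intro Ints_diff)
      also have "(y + \<epsilon> f) \<bullet> (y + \<epsilon> f) / 2 - y \<bullet> y / 2 - y \<bullet> \<epsilon> f = of_int 1 / 2"
        using f(3) by (simp add: inner_add_left inner_add_right inner_commute field_simps)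
      finally show False
        by (simp only: half_int_iff odd_one)
    qed
    ultimately show thesis
      using that[of "y + \<epsilon> f"] overlattice_add[OF M y(1) f(1)] by blast
  qed (use y that in blast)
  show thesis
    using new_eps[OF M x(1,3) F(1,3) x(2)] that by blast
qed

lemma block_eps:
  assumes "overlattice M" "\<epsilon> i + \<epsilon> j + \<epsilon> k + \<epsilon> l \<in> Lambda8" "\<epsilon> i \<in> M" "\<epsilon> j \<in> M" "\<epsilon> k \<in> M"
  shows "\<epsilon> l \<in> M"
proof -
  have "\<epsilon> i + \<epsilon> j + \<epsilon> k + \<epsilon> l - \<epsilon> i - \<epsilon> j - \<epsilon> k \<in> M"
    using assms by (intro overlattice_diff) (auto simp: overlattice_def)
  then show ?thesis by (simp add: algebra_simps)
qed

text \<open>The block used for the move avoids F, so the unit vectors already secured stay in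
  place.\<close>

lemma move_eps_fixing:
  assumes "overlattice M" "\<epsilon> i \<in> M" "F \<subseteq> {1..8}" "\<epsilon> ` F \<subseteq> M"
    and "i = j \<or> (\<exists>k l. distinct [i, j, k, l] \<and> {i, j, k, l} \<subseteq> {1..8} - F \<and>
      \<epsilon> i + \<epsilon> j + \<epsilon> k + \<epsilon> l \<in> Lambda8)"
  obtains M' where "equivalent M M'" "overlattice M'" "\<epsilon> ` insert j F \<subseteq> M'"
proof (cases "i = j")
  case True
  with assms that[of M] equivalent_refl show thesis by auto
next
  case False
  then obtain k l where kl: "distinct [i, j, k, l]" "{i, j, k, l} \<subseteq> {1..8} - F"
    "\<epsilon> i + \<epsilon> j + \<epsilon> k + \<epsilon> l \<in> Lambda8"
    using assms by blast
  obtain M' where "equivalent M M'" "overlattice M'" "\<epsilon> j \<in> M'"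
    "\<And>m. m \<in> {1..8} - {i, j, k, l} \<Longrightarrow> \<epsilon> m \<in> M \<Longrightarrow> \<epsilon> m \<in> M'"
    using move_eps[OF assms(1,2) kl(1) _ kl(3)] kl(2) by blast
  moreover have "F \<subseteq> {1..8} - {i, j, k, l}"
    using kl(2) assms(3) by auto
  ultimately show thesis
    using that[of M'] assms(4) by blast
qed

section \<open>The self-dual lattice of integral vectors\<close>

lemma Z8_eq: "Z8 = dual (\<epsilon> ` {1..8})"
proof -
  have "(\<forall>i. P i) \<longleftrightarrow> (\<forall>i\<in>{1..8}. P (of_nat i))" for P :: "8 \<Rightarrow> bool"
    using of_nat_image_8 by (metis UNIV_I imageE)
  then show ?thesis
    by (auto simp: Z8_def dual_def inner_eps)
qed

lemma Z8_subspace: "int_mod.subspace Z8"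
  by (simp add: Z8_eq dual_subspace)

lemma Z8_span: "int_span (\<epsilon> ` {1..8}) = Z8"
proof
  show "int_span (\<epsilon> ` {1..8}) \<subseteq> Z8"
    unfolding int_span_eq by (intro int_mod.span_minimal Z8_subspace) (auto simp: Z8_eq dual_def)
  show "Z8 \<subseteq> int_span (\<epsilon> ` {1..8})"
  proof
    fix x assume "x \<in> Z8"
    then have "\<forall>i\<in>{1..8}. \<exists>k. x \<bullet> \<epsilon> i = of_int k"
      unfolding Z8_eq dual_def by (simp add: Ints_def image_iff)
    then obtain n where n: "\<And>i. i \<in> {1..8} \<Longrightarrow> x \<bullet> \<epsilon> i = of_int (n i)" by metis
    have "x = (\<Sum>i=1..8. of_int (n i) *\<^sub>R \<epsilon> i)"
      by (subst eps_expand) (auto simp: n intro: sum.cong)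
    also have "\<dots> \<in> int_span (\<epsilon> ` {1..8})"
      unfolding int_span_eq by (intro int_mod.span_sum int_mod.span_scale int_mod.span_base) auto
    finally show "x \<in> int_span (\<epsilon> ` {1..8})" .
  qed
qed

text \<open>Self-duality leaves no room above \<int>^8: an integral lattice containing all
  \<epsilon>_i pairs integrally with them, so its vectors have integral coordinates.\<close>

lemma overlattice_eq_Z8:
  assumes "overlattice M" "\<epsilon> ` {1..8} \<subseteq> M"
  shows "M = Z8"
proof
  show "M \<subseteq> Z8"
    using assms dual_antimono[of "\<epsilon> ` {1..8}" M] by (auto simp: overlattice_def Z8_eq)
  show "Z8 \<subseteq> M"
    using assms unfolding Z8_span[symmetric] int_span_eq overlattice_def
    by (intro int_mod.span_minimal) auto
qed

text \<open>At each stage M is generated by \<open>Lambda8\<close> and the unit vectors collected so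
  far, or else it yields a new one. The blocks of weight 4 form a Steiner system S(3,4,8): two
  points lie in three blocks, which leaves enough choice to move the new vector to the next
  index.\<close>

lemma odd_overlattice:
  assumes M: "overlattice M" "x \<in> M" "x \<bullet> x / 2 \<notin> \<int>"
  shows "\<exists>N \<in> {adjoin Lambda8 {\<epsilon> 1}, adjoin Lambda8 {\<epsilon> 1, \<epsilon> 2},
    adjoin Lambda8 {\<epsilon> 1, \<epsilon> 2, \<epsilon> 3}, Z8}. equivalent M N"
proof -
  note block = Lambda8_iff ball8 inner_add_left
  have K0: "adjoin Lambda8 (\<epsilon> ` {}) = Lambda8"
    by (simp add: adjoin_def int_span_eq int_mod.span_eq_iff Lambda8_subspace)
  have "x \<notin> Lambda8"
    using M(3) Lambda8_inner_even by blast
  with K0 have x: "x \<notin> adjoin Lambda8 (\<epsilon> ` {})" by simp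
  obtain M0 i where M0: "equivalent M M0" "overlattice M0" "i \<in> {1..8}" "\<epsilon> i \<in> M0"
    by (rule new_eps[OF M _ _ x]) (simp, simp, blast)
  have m1: "i = 1 \<or> (\<exists>k l. distinct [i, 1, k, l] \<and> {i, 1, k, l} \<subseteq> {1..8} - {} \<and>
      \<epsilon> i + \<epsilon> 1 + \<epsilon> k + \<epsilon> l \<in> Lambda8)"
  proof -
    consider "i = 1" | "i = 2" | "i = 3" | "i = 4" | "i = 5" | "i = 6" | "i = 7" | "i = 8"
      using M0(3) by (auto simp: set8)
    then show ?thesis
    proof cases
      case 2 then show ?thesis by (intro disjI2 exI[of _ 3] exI[of _ 4]) (simp add: block)
    next
      case 3 then show ?thesis by (intro disjI2 exI[of _ 2] exI[of _ 4]) (simp add: block)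
    next
      case 4 then show ?thesis by (intro disjI2 exI[of _ 2] exI[of _ 3]) (simp add: block)
    next
      case 5 then show ?thesis by (intro disjI2 exI[of _ 2] exI[of _ 6]) (simp add: block)
    next
      case 6 then show ?thesis by (intro disjI2 exI[of _ 2] exI[of _ 5]) (simp add: block)
    next
      case 7 then show ?thesis by (intro disjI2 exI[of _ 2] exI[of _ 8]) (simp add: block)
    next
      case 8 then show ?thesis by (intro disjI2 exI[of _ 2] exI[of _ 7]) (simp add: block)
    qed simp
  qed
  obtain M1
    where M1: "equivalent M0 M1" "overlattice M1" "\<epsilon> ` {1} \<subseteq> M1"
    by (rule move_eps_fixing[OF M0(2,4) _ _ m1]) (simp, simp, blast)
  have E1: "equivalent M M1"
    by (rule equivalent_trans[OF M0(1) M1(1)])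
  show ?thesis
  proof (cases "M1 = adjoin Lambda8 (\<epsilon> ` {1})")
    case True
    with E1 show ?thesis by auto
  next
    case False
    obtain M1' i where M1': "equivalent M1 M1'" "overlattice M1'" "\<epsilon> ` {1} \<subseteq> M1'"
      "i \<in> {1..8}" "\<epsilon> i \<in> M1'" and i: "\<epsilon> i \<notin> adjoin Lambda8 (\<epsilon> ` {1})"
      by (rule next_eps[OF M1(2) _ _ M1(3) False, of 1]) (simp, simp, blast)
    have "i \<noteq> 1"
      using i adjoin_superset[of Lambda8 "\<epsilon> ` {1}"] by auto
    then consider "i = 2" | "i = 3" | "i = 4" | "i = 5" | "i = 6" | "i = 7" | "i = 8"
      using M1'(4) by (auto simp: set8)
    \<comment> \<open>Of the three blocks through i and 2, just one contains 1; k and l complete one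
      of the other two.\<close>
    then have m2: "i = 2 \<or> (\<exists>k l. distinct [i, 2, k, l] \<and> {i, 2, k, l} \<subseteq> {1..8} - {1} \<and>
        \<epsilon> i + \<epsilon> 2 + \<epsilon> k + \<epsilon> l \<in> Lambda8)"
    proof cases
      case 2 then show ?thesis by (intro disjI2 exI[of _ 6] exI[of _ 7]) (simp add: block)
    next
      case 3 then show ?thesis by (intro disjI2 exI[of _ 6] exI[of _ 8]) (simp add: block)
    next
      case 4 then show ?thesis by (intro disjI2 exI[of _ 4] exI[of _ 7]) (simp add: block)
    next
      case 5 then show ?thesis by (intro disjI2 exI[of _ 4] exI[of _ 8]) (simp add: block)
    next
      case 6 then show ?thesis by (intro disjI2 exI[of _ 4] exI[of _ 5]) (simp add: block)
    next
      case 7 then show ?thesis by (intro disjI2 exI[of _ 4] exI[of _ 6]) (simp add: block)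
    qed simp
    obtain M2
      where M2: "equivalent M1' M2" "overlattice M2" "\<epsilon> ` {2, 1} \<subseteq> M2"
      by (rule move_eps_fixing[OF M1'(2,5) _ M1'(3) m2]) (simp, blast)
    have E2: "equivalent M M2"
      by (rule equivalent_trans[OF E1 equivalent_trans[OF M1'(1) M2(1)]])
    show ?thesis
    proof (cases "M2 = adjoin Lambda8 (\<epsilon> ` {2, 1})")
      case True
      with E2 show ?thesis by (auto simp: insert_commute)
    next
      case False
      obtain M2' i where M2': "equivalent M2 M2'" "overlattice M2'" "\<epsilon> ` {2, 1} \<subseteq> M2'"
        "i \<in> {1..8}" "\<epsilon> i \<in> M2'" and i: "\<epsilon> i \<notin> adjoin Lambda8 (\<epsilon> ` {2, 1})"
        by (rule next_eps[OF M2(2) _ _ M2(3) False, of 1]) (simp, simp, blast)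
      have "i \<noteq> 1" "i \<noteq> 2"
        using i adjoin_superset[of Lambda8 "\<epsilon> ` {2, 1}"] by auto
      then consider "i = 3" | "i = 4" | "i = 5" | "i = 6" | "i = 7" | "i = 8"
        using M2'(4) by (auto simp: set8)
      \<comment> \<open>If i = 4, the codeword on {1,2,3,4} already puts \<epsilon>_3 into the
        lattice. For larger i, one of {3,4,5,6} and {3,4,7,8} contains both i and 3 and avoids 1 and
        2.\<close>
      then obtain j where j: "\<epsilon> j \<in> M2'" "j = 3 \<or> (\<exists>k l. distinct [j, 3, k, l] \<and>
          {j, 3, k, l} \<subseteq> {1..8} - {2, 1} \<and> \<epsilon> j + \<epsilon> 3 + \<epsilon> k + \<epsilon> l \<in> Lambda8)"
      proof cases
        case 1 with M2'(5) show thesis by (intro that[of 3]) simp_all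
      next
        case 2
        have "\<epsilon> 1 + \<epsilon> 2 + \<epsilon> 4 + \<epsilon> 3 \<in> Lambda8"
          by (simp add: block)
        with 2 M2' show thesis
          by (intro that[of 3] block_eps[OF M2'(2), of 1 2 4 3]) auto
      next
        case 3 with M2'(5) show thesis
          by (intro that[of 5] disjI2 exI[of _ 4] exI[of _ 6]) (simp_all add: block)
      next
        case 4 with M2'(5) show thesis
          by (intro that[of 6] disjI2 exI[of _ 4] exI[of _ 5]) (simp_all add: block)
      next
        case 5 with M2'(5) show thesis
          by (intro that[of 7] disjI2 exI[of _ 4] exI[of _ 8]) (simp_all add: block)
      next
        case 6 with M2'(5) show thesis
          by (intro that[of 8] disjI2 exI[of _ 4] exI[of _ 7]) (simp_all add: block)
      qed
      obtain M3
        where M3: "equivalent M2' M3" "overlattice M3" "\<epsilon> ` {3, 2, 1} \<subseteq> M3"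
        by (rule move_eps_fixing[OF M2'(2) j(1) _ M2'(3) j(2)]) (simp, blast)
      have E3: "equivalent M M3"
        by (rule equivalent_trans[OF E2 equivalent_trans[OF M2'(1) M3(1)]])
      show ?thesis
      proof (cases "M3 = adjoin Lambda8 (\<epsilon> ` {3, 2, 1})")
        case True
        with E3 show ?thesis by (auto simp: insert_commute)
      next
        case False
        obtain M4 i where M4: "equivalent M3 M4" "overlattice M4" "\<epsilon> ` {3, 2, 1} \<subseteq> M4"
          "i \<in> {1..8}" "\<epsilon> i \<in> M4" and i: "\<epsilon> i \<notin> adjoin Lambda8 (\<epsilon> ` {3, 2, 1})"
          by (rule next_eps[OF M3(2) _ _ M3(3) False, of 1]) (simp, simp, blast)
        have "i \<noteq> 1" "i \<noteq> 2" "i \<noteq> 3"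
          using i adjoin_superset[of Lambda8 "\<epsilon> ` {3, 2, 1}"] by auto
        \<comment> \<open>The codeword on {1,2,3,4} makes \<epsilon>_4 a combination of what is
          already generated, so it is not new.\<close>
        have "i \<noteq> 4"
        proof
          assume "i = 4"
          have "\<epsilon> 1 + \<epsilon> 2 + \<epsilon> 3 + \<epsilon> 4 \<in> Lambda8"
            by (simp add: block)
          then have "\<epsilon> 1 + \<epsilon> 2 + \<epsilon> 3 + \<epsilon> 4 - \<epsilon> 1 - \<epsilon> 2 - \<epsilon> 3 \<in> adjoin Lambda8 (\<epsilon> ` {3, 2, 1})"
            using adjoin_superset[of Lambda8 "\<epsilon> ` {3, 2, 1}"]
            by (intro int_mod.subspace_diff[OF adjoin_subspace]) auto
          with i \<open>i = 4\<close> show False by (simp add: algebra_simps)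
        qed
        \<comment> \<open>\<open>block_eps\<close> extracts the last summand, so the order matters:
          versions ending in 5 lead from 6, 7 or 8 to \<epsilon>_5, their partners lead from
          \<epsilon>_5 back to the rest.\<close>
        have B: "\<epsilon> 1 + \<epsilon> 2 + \<epsilon> 3 + \<epsilon> 4 \<in> Lambda8"
          "\<epsilon> 1 + \<epsilon> 2 + \<epsilon> 5 + \<epsilon> 6 \<in> Lambda8" "\<epsilon> 1 + \<epsilon> 2 + \<epsilon> 6 + \<epsilon> 5 \<in> Lambda8"
          "\<epsilon> 1 + \<epsilon> 3 + \<epsilon> 5 + \<epsilon> 7 \<in> Lambda8" "\<epsilon> 1 + \<epsilon> 3 + \<epsilon> 7 + \<epsilon> 5 \<in> Lambda8"
          "\<epsilon> 2 + \<epsilon> 3 + \<epsilon> 5 + \<epsilon> 8 \<in> Lambda8" "\<epsilon> 2 + \<epsilon> 3 + \<epsilon> 8 + \<epsilon> 5 \<in> Lambda8"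
          by (simp_all add: block)
        note close = B[THEN block_eps[OF M4(2)]]
        have e: "\<epsilon> 1 \<in> M4" "\<epsilon> 2 \<in> M4" "\<epsilon> 3 \<in> M4"
          using M4(3) by auto
        have e4: "\<epsilon> 4 \<in> M4"
          using e close(1) by blast
        from \<open>i \<noteq> 1\<close> \<open>i \<noteq> 2\<close> \<open>i \<noteq> 3\<close> \<open>i \<noteq> 4\<close>
        consider "i = 5" | "i = 6" | "i = 7" | "i = 8"
          using M4(4) by (auto simp: set8)
        then have e5: "\<epsilon> 5 \<in> M4"
          using e M4(5) close(3,5,7) by cases auto
        then have "\<epsilon> 6 \<in> M4" "\<epsilon> 7 \<in> M4" "\<epsilon> 8 \<in> M4"
          using e close(2,4,6) by blast+
        with e e4 e5 have "\<epsilon> ` {1..8} \<subseteq> M4"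
          by (simp add: set8)
        then have "M4 = Z8"
          by (rule overlattice_eq_Z8[OF M4(2)])
        moreover have "equivalent M M4"
          by (rule equivalent_trans[OF E3 M4(1)])
        ultimately show ?thesis by blast
      qed
    qed
  qed
qed

subsection \<open>Even sublattices\<close>

text \<open>On an integral lattice the norm is additive mod 2, and this is the kernel.\<close>

definition even_part :: "'a::real_inner set \<Rightarrow> 'a set" where
  "even_part N = {x \<in> N. x \<bullet> x / 2 \<in> \<int>}"

lemma even_part_image:
  "orthogonal_transformation g \<Longrightarrow> even_part (g ` N) = g ` even_part N"
  by (auto simp: even_part_def orthogonal_transformation_def)

text \<open>The norm of e + kv is congruent to k^2 (v.v) mod 2 with v.v odd, so even norm forces k
  even, and 2v already lies in E.\<close>

lemma even_part_insert:
  assumes E: "int_mod.subspace E" "\<And>x. x \<in> E \<Longrightarrow> x \<bullet> x / 2 \<in> \<int>"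
    and v: "v \<in> dual E" "v \<bullet> v \<in> \<int>" "v \<bullet> v / 2 \<notin> \<int>" "2 *\<^sub>R v \<in> E"
  shows "even_part (int_span (insert v E)) = E"
proof
  show "E \<subseteq> even_part (int_span (insert v E))"
    using E(2) by (auto simp: even_part_def int_span_eq intro: int_mod.span_base)
  show "even_part (int_span (insert v E)) \<subseteq> E"
  proof
    fix x assume "x \<in> even_part (int_span (insert v E))"
    then have x: "x \<in> int_mod.span (insert v E)" "x \<bullet> x / 2 \<in> \<int>"
      by (auto simp: even_part_def int_span_eq)
    have "int_mod.span E = E"
      using E(1) by (metis int_mod.span_eq_iff)
    with x(1) obtain k where k: "x - of_int k *\<^sub>R v \<in> E"
      unfolding int_mod.span_insert by auto
    define e where "e = x - of_int k *\<^sub>R v"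
    have xe: "x = e + of_int k *\<^sub>R v"
      by (simp add: e_def)
    have e: "e \<in> E" "v \<bullet> e \<in> \<int>"
      using k v(1) by (auto simp: e_def dual_def)
    obtain m where m: "v \<bullet> v = of_int m"
      using v(2) by (elim Ints_cases)
    then have "odd m"
      using v(3) half_int_iff[of m] by auto
    have "x \<bullet> x / 2 - e \<bullet> e / 2 - of_int k * (v \<bullet> e) \<in> \<int>"
      using x(2) E(2)[OF e(1)] e(2) by (intro Ints_diff Ints_mult) auto
    also have "x \<bullet> x / 2 - e \<bullet> e / 2 - of_int k * (v \<bullet> e) = of_int (k * k * m) / 2"
      by (simp add: xe inner_add_left inner_add_right inner_commute m field_simps)
    finally have "even (k * k * m)"
      by (simp only: half_int_iff)
    with \<open>odd m\<close> have "even k"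
      by simp
    then obtain j where j: "k = 2 * j"
      by (elim evenE)
    have "of_int k *\<^sub>R v = of_int j *\<^sub>R (2 *\<^sub>R v)"
      by (simp add: j)
    also have "\<dots> \<in> E"
      using int_mod.subspace_scale[OF E(1) v(4)] .
    finally show "x \<in> E"
      using int_mod.subspace_add[OF E(1) e(1)] by (simp add: xe)
  qed
qed

text \<open>An integer and its square have the same parity.\<close>

lemma even_norm_Z8:
  assumes x: "x \<in> Z8" and sum: "(\<Sum>i=1..8. x \<bullet> \<epsilon> i) / 2 \<in> \<int>"
  shows "x \<bullet> x / 2 \<in> \<int>"
proof -
  have "\<forall>i\<in>{1..8}. \<exists>k. x \<bullet> \<epsilon> i = of_int k"
    using x unfolding Z8_eq dual_def by (simp add: Ints_def image_iff)
  then obtain n where n: "\<And>i. i \<in> {1..8} \<Longrightarrow> x \<bullet> \<epsilon> i = of_int (n i)" by metis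
  have xx: "x \<bullet> x = of_int (\<Sum>i=1..8. n i * n i)"
    by (subst inner_eps_expand) (simp add: n)
  have "(\<Sum>i=1..8. x \<bullet> \<epsilon> i) = of_int (\<Sum>i=1..8. n i)"
    by (simp add: n)
  then have "even (\<Sum>i=1..8. n i)"
    using sum by (simp only: half_int_iff)
  moreover have "even ((\<Sum>i=1..8. n i * n i) - (\<Sum>i=1..8. n i))"
    unfolding sum_subtractf[symmetric] by (intro dvd_sum) auto
  ultimately have "even (\<Sum>i=1..8. n i * n i)"
    by simp
  then show ?thesis
    unfolding xx half_int_iff .
qed

text \<open>The glue vector of E_8 over D_8. It also turns the even coordinate sum into a duality
  condition: integrality against it and all \<epsilon>_i cuts out D_8.\<close>

definition half_sum :: "real ^ 8" where
  "half_sum = (1/2) *\<^sub>R (\<Sum>i=1..8. \<epsilon> i)"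

lemma inner_half_sum: "x \<bullet> half_sum = (\<Sum>i=1..8. x \<bullet> \<epsilon> i) / 2"
  by (simp add: half_sum_def inner_sum_right)

lemma eps_inner_half_sum: "i \<in> {1..8} \<Longrightarrow> \<epsilon> i \<bullet> half_sum = 1/2"
  by (simp add: inner_half_sum)

text \<open>The all-ones word belongs to the code.\<close>

lemma Lambda8_half_sum: "x \<in> Lambda8 \<Longrightarrow> x \<bullet> half_sum \<in> \<int>"
proof -
  assume x: "x \<in> Lambda8"
  have "2 *\<^sub>R half_sum = (\<epsilon> 1 + \<epsilon> 2 + \<epsilon> 3 + \<epsilon> 4) + (\<epsilon> 5 + \<epsilon> 6 + \<epsilon> 7 + \<epsilon> 8)"
    by (simp add: half_sum_def sum8)
  also have "\<dots> \<in> Lambda8"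
    by (simp add: Lambda8_iff ball8 inner_add_left)
  finally show ?thesis
    using Lambda8_inner_even[OF x] by fastforce
qed

lemma even_norm_in_dual:
  assumes "x \<in> dual (insert half_sum (\<epsilon> ` {1..8}))"
  shows "x \<bullet> x / 2 \<in> \<int>"
proof (rule even_norm_Z8)
  show "x \<in> Z8"
    using assms by (simp add: Z8_eq dual_def)
  show "(\<Sum>i=1..8. x \<bullet> \<epsilon> i) / 2 \<in> \<int>"
    using assms by (simp add: dual_def inner_half_sum)
qed

lemma signed_pair_dual:
  assumes "i \<in> {1..8}" "j \<in> {1..8}" "s \<in> {1, -1}" "t \<in> {1, -1}"
  shows "s *\<^sub>R \<epsilon> i + t *\<^sub>R \<epsilon> j \<in> dual (insert half_sum (\<epsilon> ` {1..8}))"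
proof -
  have "(s *\<^sub>R \<epsilon> i + t *\<^sub>R \<epsilon> j) \<bullet> half_sum \<in> \<int>"
    using assms by (auto simp: inner_add_left eps_inner_half_sum)
  moreover have "(s *\<^sub>R \<epsilon> i + t *\<^sub>R \<epsilon> j) \<bullet> \<epsilon> k \<in> \<int>" if "k \<in> {1..8}" for k
    using assms that by (auto simp: inner_add_left)
  ultimately show ?thesis
    by (simp add: dual_def)
qed

lemma Lambda8_subset_dual: "Lambda8 \<subseteq> dual (insert half_sum (\<epsilon> ` {1..8}))"
  using Lambda8_half_sum by (auto simp: dual_def Lambda8_iff)

text \<open>A sign change alters the vector by some \<open>2 *\<^sub>R \<epsilon> i\<close>, which
  \<open>Lambda8\<close> supplies.\<close>

lemma signed_pair_mem:
  assumes S: "int_mod.subspace S" "Lambda8 \<subseteq> S" "\<epsilon> i + \<epsilon> j \<in> S"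
    and ij: "i \<in> {1..8}" "j \<in> {1..8}" and st: "s \<in> {1, -1}" "t \<in> {1, -1}"
  shows "s *\<^sub>R \<epsilon> i + t *\<^sub>R \<epsilon> j \<in> S"
proof -
  have 2: "2 *\<^sub>R \<epsilon> i \<in> S" "2 *\<^sub>R \<epsilon> j \<in> S"
    using S(2) two_eps_in_Lambda8 ij by blast+
  have "of_int a *\<^sub>R (2 *\<^sub>R \<epsilon> i) + of_int b *\<^sub>R (2 *\<^sub>R \<epsilon> j) + (\<epsilon> i + \<epsilon> j) \<in> S" for a b
    by (rule int_mod.subspace_add[OF S(1) _ S(3)],
        rule int_mod.subspace_add[OF S(1) int_mod.subspace_scale[OF S(1) 2(1)]
          int_mod.subspace_scale[OF S(1) 2(2)]])
  from this[of "if s = 1 then 0 else - 1" "if t = 1 then 0 else - 1"] show ?thesis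
    using st by (auto simp: scaleR_2 algebra_simps)
qed

lemma eps_1_dual: "E \<subseteq> dual (insert half_sum (\<epsilon> ` {1..8})) \<Longrightarrow> \<epsilon> 1 \<in> dual E"
proof -
  assume "E \<subseteq> dual (insert half_sum (\<epsilon> ` {1..8}))"
  moreover have "\<epsilon> 1 \<in> insert half_sum (\<epsilon> ` {1..8})" by simp
  ultimately show "\<epsilon> 1 \<in> dual E"
    using subset_dual_swap[of E "insert half_sum (\<epsilon> ` {1..8})"] by blast
qed

text \<open>An instance of \<open>even_part_insert\<close> with v = \<epsilon>_1, once K is
  generated by E and \<epsilon>_1. The set X generates K, so only its elements have to be expressed
  through these.\<close>

lemma even_part_eqI:
  assumes E: "int_mod.subspace E" "E \<subseteq> dual (insert half_sum (\<epsilon> ` {1..8}))" "2 *\<^sub>R \<epsilon> 1 \<in> E"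
    and K: "int_span X = K" "\<epsilon> 1 \<in> K" "E \<subseteq> K" "X \<subseteq> int_span (insert (\<epsilon> 1) E)"
  shows "even_part K = E"
proof -
  have "K = int_span (insert (\<epsilon> 1) E)"
  proof
    show "K \<subseteq> int_span (insert (\<epsilon> 1) E)"
      using K(4) unfolding K(1)[symmetric] int_span_eq by (intro int_mod.span_minimal) auto
    show "int_span (insert (\<epsilon> 1) E) \<subseteq> K"
      using K(2,3) unfolding int_span_eq K(1)[symmetric] by (intro int_mod.span_minimal) auto
  qed
  moreover have "\<epsilon> 1 \<bullet> \<epsilon> 1 = 1"
    by simp
  moreover have "(1::real) / 2 \<notin> \<int>"
    using half_int_iff[of 1] by simp
  ultimately show ?thesis
    using even_part_insert[OF E(1) even_norm_in_dual, of "\<epsilon> 1"] E(2,3) eps_1_dual[OF E(2)] by auto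
qed

lemma span_eps_shift:
  assumes "int_mod.subspace E" "\<epsilon> 1 - \<epsilon> i \<in> E"
  shows "\<epsilon> i \<in> int_span (insert (\<epsilon> 1) E)"
proof -
  have "\<epsilon> 1 - (\<epsilon> 1 - \<epsilon> i) \<in> int_span (insert (\<epsilon> 1) E)"
    unfolding int_span_eq using assms(2) by (intro int_mod.span_diff int_mod.span_base) auto
  then show ?thesis by simp
qed

section \<open>Even parts of the four odd lattices\<close>

lemma even_part_Lambda8_1: "even_part (adjoin Lambda8 {\<epsilon> 1}) = Lambda8"
proof (rule even_part_eqI[OF Lambda8_subspace Lambda8_subset_dual])
  show "2 *\<^sub>R \<epsilon> 1 \<in> Lambda8"
    by (rule two_eps_in_Lambda8) simp
  show "int_span (Lambda8 \<union> {\<epsilon> 1}) = adjoin Lambda8 {\<epsilon> 1}"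
    by (simp add: adjoin_def)
  show "Lambda8 \<union> {\<epsilon> 1} \<subseteq> int_span (insert (\<epsilon> 1) Lambda8)"
    by (auto simp: int_span_eq intro: int_mod.span_base)
qed (use adjoin_superset[of Lambda8 "{\<epsilon> 1}"] in auto)

lemma adjoin_block_pair:
  assumes "\<epsilon> i \<in> adjoin Lambda8 X" "\<epsilon> j \<in> adjoin Lambda8 X" "\<epsilon> i + \<epsilon> j + \<epsilon> k + \<epsilon> l \<in> Lambda8"
  shows "\<epsilon> k + \<epsilon> l \<in> adjoin Lambda8 X"
proof -
  have "\<epsilon> i + \<epsilon> j + \<epsilon> k + \<epsilon> l \<in> adjoin Lambda8 X"
    using assms(3) adjoin_superset[of Lambda8 X] by blast
  then have "\<epsilon> i + \<epsilon> j + \<epsilon> k + \<epsilon> l - (\<epsilon> i + \<epsilon> j) \<in> adjoin Lambda8 X"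
    using assms(1,2) adjoin_subspace[of Lambda8 X]
    by (intro int_mod.subspace_diff int_mod.subspace_add[of _ "\<epsilon> i" "\<epsilon> j"])
  then show ?thesis by (simp add: algebra_simps)
qed

text \<open>The pair {1,2} together with any of {3,4}, {5,6}, {7,8} supports a codeword, so
  \<epsilon>_1 and \<epsilon>_2 bring in all generators of \<open>A1_8\<close>.\<close>

lemma even_part_Lambda8_2: "even_part (adjoin Lambda8 {\<epsilon> 1, \<epsilon> 2}) = adjoin Lambda8 A1_8"
proof (rule even_part_eqI)
  let ?K = "adjoin Lambda8 {\<epsilon> 1, \<epsilon> 2}" and ?E = "adjoin Lambda8 A1_8"
  let ?G = "{s *\<^sub>R (\<epsilon> (2 * i - 1) + t *\<^sub>R \<epsilon> (2 * i)) | s t i.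
     s \<in> {1, -1::real} \<and> t \<in> {1, -1} \<and> i \<in> {1..4}}"
  have L: "Lambda8 \<subseteq> ?K" and e: "\<epsilon> 1 \<in> ?K" "\<epsilon> 2 \<in> ?K"
    using adjoin_superset[of Lambda8 "{\<epsilon> 1, \<epsilon> 2}"] by auto
  \<comment> \<open>The signs s(1, t) are rewritten as (s, st), again an arbitrary pair of signs,
    the form in which the lemmas on signed pairs apply.\<close>
  have G: "s *\<^sub>R (\<epsilon> (2 * i - 1) + t *\<^sub>R \<epsilon> (2 * i)) \<in> S"
    if "s \<in> {1, -1}" "t \<in> {1, -1}" "i \<in> {1..4}"
      "\<And>s t. s \<in> {1, -1} \<Longrightarrow> t \<in> {1, -1} \<Longrightarrow> s *\<^sub>R \<epsilon> (2 * i - 1) + t *\<^sub>R \<epsilon> (2 * i) \<in> S" for s t i S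
  proof -
    have "s *\<^sub>R \<epsilon> (2 * i - 1) + (s * t) *\<^sub>R \<epsilon> (2 * i) \<in> S"
      using that(1-3) by (intro that(4)) auto
    then show ?thesis by (simp add: scaleR_add_right)
  qed
  show "int_mod.subspace ?E" by (rule adjoin_subspace)
  have "?G \<subseteq> dual (insert half_sum (\<epsilon> ` {1..8}))"
  proof clarify
    fix s t :: real and i :: nat assume *: "s \<in> {1, -1}" "t \<in> {1, -1}" "i \<in> {1..4}"
    then show "s *\<^sub>R (\<epsilon> (2 * i - 1) + t *\<^sub>R \<epsilon> (2 * i)) \<in> dual (insert half_sum (\<epsilon> ` {1..8}))"
      by (intro G signed_pair_dual) auto
  qed
  then show "?E \<subseteq> dual (insert half_sum (\<epsilon> ` {1..8}))"
    using Lambda8_subset_dual dual_subspace unfolding A1_8_def int_span_eq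
    by (intro adjoin_least Un_least int_mod.span_minimal)
  show "2 *\<^sub>R \<epsilon> 1 \<in> ?E"
    using adjoin_superset[of Lambda8 A1_8] two_eps_in_Lambda8[of 1] by auto
  show "int_span (Lambda8 \<union> {\<epsilon> 1, \<epsilon> 2}) = ?K"
    by (simp add: adjoin_def)
  show "\<epsilon> 1 \<in> ?K" by (rule e)
  have "\<epsilon> (2 * i - 1) + \<epsilon> (2 * i) \<in> ?K" if "i \<in> {1..4}" for i
  proof -
    have "i = 1 \<or> i = 2 \<or> i = 3 \<or> i = 4"
      using that by auto
    then consider "i = 1" | "i = 2" | "i = 3" | "i = 4"
      by blast
    then show ?thesis
    proof cases
      case 1 then show ?thesis
        using int_mod.subspace_add[OF adjoin_subspace e] by (simp add: One_nat_def)
    next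
      case 2 then show ?thesis
        using adjoin_block_pair[OF e, of 3 4] by (simp add: Lambda8_iff ball8 inner_add_left)
    next
      case 3 then show ?thesis
        using adjoin_block_pair[OF e, of 5 6] by (simp add: Lambda8_iff ball8 inner_add_left)
    next
      case 4 then show ?thesis
        using adjoin_block_pair[OF e, of 7 8] by (simp add: Lambda8_iff ball8 inner_add_left)
    qed
  qed
  then have "?G \<subseteq> ?K"
  proof clarify
    fix s t :: real and i :: nat assume *: "s \<in> {1, -1}" "t \<in> {1, -1}" "i \<in> {1..4}"
      and K: "\<And>i. i \<in> {1..4} \<Longrightarrow> \<epsilon> (2 * i - 1) + \<epsilon> (2 * i) \<in> ?K"
    then show "s *\<^sub>R (\<epsilon> (2 * i - 1) + t *\<^sub>R \<epsilon> (2 * i)) \<in> ?K"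
      by (intro G signed_pair_mem[OF adjoin_subspace L]) auto
  qed
  then show "?E \<subseteq> ?K"
    using L adjoin_subspace unfolding A1_8_def int_span_eq
    by (intro adjoin_least Un_least int_mod.span_minimal)
  have "1 *\<^sub>R (\<epsilon> (2 * 1 - 1) + (-1) *\<^sub>R \<epsilon> (2 * 1)) \<in> ?G"
    by (intro CollectI exI[of _ 1] exI[of _ "-1"]) auto
  then have "1 *\<^sub>R (\<epsilon> (2 * 1 - 1) + (-1) *\<^sub>R \<epsilon> (2 * 1)) \<in> A1_8"
    unfolding A1_8_def int_span_eq by (rule int_mod.span_base)
  then have "\<epsilon> 1 - \<epsilon> 2 \<in> A1_8"
    by (simp add: One_nat_def)
  then have "\<epsilon> 1 - \<epsilon> 2 \<in> ?E"
    using adjoin_superset[of Lambda8 A1_8] by blast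
  then have "\<epsilon> 2 \<in> int_span (insert (\<epsilon> 1) ?E)"
    by (rule span_eps_shift[OF adjoin_subspace])
  moreover have "insert (\<epsilon> 1) Lambda8 \<subseteq> int_span (insert (\<epsilon> 1) ?E)"
    using adjoin_superset[of Lambda8 A1_8] by (auto simp: int_span_eq intro: int_mod.span_base)
  ultimately show "Lambda8 \<union> {\<epsilon> 1, \<epsilon> 2} \<subseteq> int_span (insert (\<epsilon> 1) ?E)"
    by blast
qed

text \<open>Sum and difference of a pair give the doubled unit vectors, and each codeword generator
  splits into two listed pairs. All pairs lie within {1..4} or {5..8}, so the criterion serves
  \<open>D4_2\<close> as well as \<open>D8\<close>.\<close>

lemma Lambda8_subset:
  assumes S: "int_mod.subspace S"
    and plus: "\<And>i j. (i, j) \<in> {(1,2), (3,4), (1,3), (5,6), (5,7), (2,4), (6,8)} \<Longrightarrow>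
      \<epsilon> i + \<epsilon> j \<in> S \<and> \<epsilon> i - \<epsilon> j \<in> S"
  shows "Lambda8 \<subseteq> S"
proof -
  have two: "2 *\<^sub>R \<epsilon> i \<in> S" "2 *\<^sub>R \<epsilon> j \<in> S" if "\<epsilon> i + \<epsilon> j \<in> S \<and> \<epsilon> i - \<epsilon> j \<in> S" for i j
    using int_mod.subspace_add[OF S, of "\<epsilon> i + \<epsilon> j" "\<epsilon> i - \<epsilon> j"]
      int_mod.subspace_diff[OF S, of "\<epsilon> i + \<epsilon> j" "\<epsilon> i - \<epsilon> j"] that
    by (auto simp: scaleR_2)
  have four: "\<epsilon> i + \<epsilon> j + \<epsilon> k + \<epsilon> l \<in> S" if "\<epsilon> i + \<epsilon> j \<in> S" "\<epsilon> k + \<epsilon> l \<in> S" for i j k l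
    using int_mod.subspace_add[OF S that] by (simp add: add_ac)
  note p = plus[of 1 2] plus[of 3 4] plus[of 1 3] plus[of 5 6] plus[of 5 7] plus[of 2 4] plus[of 6 8]
  have "2 *\<^sub>R \<epsilon> 1 \<in> S" "2 *\<^sub>R \<epsilon> 2 \<in> S" "2 *\<^sub>R \<epsilon> 3 \<in> S" "2 *\<^sub>R \<epsilon> 5 \<in> S"
    using two(1)[of 1 2] two(2)[of 1 2] two(2)[of 1 3] two(1)[of 5 6] p by simp_all
  moreover have "\<epsilon> 1 + \<epsilon> 2 + \<epsilon> 3 + \<epsilon> 4 \<in> S" "\<epsilon> 1 + \<epsilon> 2 + \<epsilon> 5 + \<epsilon> 6 \<in> S"
    using p by (auto intro: four)
  moreover have "\<epsilon> 1 + \<epsilon> 3 + \<epsilon> 5 + \<epsilon> 7 \<in> S" "\<epsilon> 2 + \<epsilon> 4 + \<epsilon> 6 + \<epsilon> 8 \<in> S"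
    using p by (auto intro: four)
  ultimately show ?thesis
    unfolding Lambda8_def int_span_eq using S by (intro int_mod.span_minimal) auto
qed

lemma D4_2_pair:
  assumes "1 \<le> i \<and> i < j \<and> j \<le> 4 \<or> 5 \<le> i \<and> i < j \<and> j \<le> 8"
  shows "\<epsilon> i + \<epsilon> j \<in> D4_2 \<and> \<epsilon> i - \<epsilon> j \<in> D4_2"
proof -
  have "1 *\<^sub>R \<epsilon> i + t *\<^sub>R \<epsilon> j \<in> D4_2" if "t \<in> {1, -1}" for t
    unfolding D4_2_def int_span_eq using assms that by (intro int_mod.span_base) blast
  from this[of 1] this[of "-1"] show ?thesis by simp
qed

lemma D8_pair:
  assumes "1 \<le> i" "i < j" "j \<le> 8"
  shows "\<epsilon> i + \<epsilon> j \<in> D8 \<and> \<epsilon> i - \<epsilon> j \<in> D8"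
proof -
  have "1 *\<^sub>R \<epsilon> i + t *\<^sub>R \<epsilon> j \<in> D8" if "t \<in> {1, -1}" for t
    unfolding D8_def int_span_eq using assms that by (intro int_mod.span_base) blast
  from this[of 1] this[of "-1"] show ?thesis by simp
qed

lemma D4_2_subspace: "int_mod.subspace D4_2" and D8_subspace: "int_mod.subspace D8"
  by (simp_all add: D4_2_def D8_def int_span_eq)

text \<open>The codeword on {1,2,3,4} supplies \<epsilon>_4, and each pair in {5..8} completes some
  pair in {1,2,3} to a codeword.\<close>

lemma even_part_Lambda8_3: "even_part (adjoin Lambda8 {\<epsilon> 1, \<epsilon> 2, \<epsilon> 3}) = D4_2"
proof (rule even_part_eqI)
  let ?K = "adjoin Lambda8 {\<epsilon> 1, \<epsilon> 2, \<epsilon> 3}"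
  let ?P = "\<lambda>i j. 1 \<le> i \<and> i < j \<and> j \<le> 4 \<or> 5 \<le> i \<and> i < j \<and> j \<le> (8::nat)"
  note block = Lambda8_iff ball8 inner_add_left
  have L: "Lambda8 \<subseteq> ?K" and e: "\<epsilon> 1 \<in> ?K" "\<epsilon> 2 \<in> ?K" "\<epsilon> 3 \<in> ?K"
    using adjoin_superset[of Lambda8 "{\<epsilon> 1, \<epsilon> 2, \<epsilon> 3}"] by auto
  show "int_mod.subspace D4_2" by (rule D4_2_subspace)
  show "D4_2 \<subseteq> dual (insert half_sum (\<epsilon> ` {1..8}))"
    unfolding D4_2_def int_span_eq
  proof (intro int_mod.span_minimal dual_subspace, clarify)
    fix s t :: real and i j assume "?P i j" "s \<in> {1, -1}" "t \<in> {1, -1}"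
    then show "s *\<^sub>R \<epsilon> i + t *\<^sub>R \<epsilon> j \<in> dual (insert half_sum (\<epsilon> ` {1..8}))"
      by (intro signed_pair_dual) auto
  qed
  have LD: "Lambda8 \<subseteq> D4_2"
    by (rule Lambda8_subset[OF D4_2_subspace], rule D4_2_pair) auto
  then show "2 *\<^sub>R \<epsilon> 1 \<in> D4_2"
    using two_eps_in_Lambda8[of 1] by auto
  show "int_span (Lambda8 \<union> {\<epsilon> 1, \<epsilon> 2, \<epsilon> 3}) = ?K"
    by (simp add: adjoin_def)
  show "\<epsilon> 1 \<in> ?K" by (rule e)
  have "\<epsilon> 3 + \<epsilon> 4 \<in> ?K"
    using adjoin_block_pair[OF e(1,2), of 3 4] by (simp add: block)
  then have e4: "\<epsilon> 4 \<in> ?K"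
    using int_mod.subspace_diff[OF adjoin_subspace _ e(3)] by fastforce
  have pair: "\<epsilon> i + \<epsilon> j \<in> ?K" if "?P i j" for i j
  proof (cases "j \<le> 4")
    case True
    with that have "i \<in> {1,2,3,4}" "j \<in> {1,2,3,4}" by auto
    then have "\<epsilon> i \<in> ?K" "\<epsilon> j \<in> ?K"
      using e e4 by auto
    then show ?thesis
      by (rule int_mod.subspace_add[OF adjoin_subspace])
  next
    case False
    with that have "(i, j) \<in> {(5,6), (5,7), (5,8), (6,7), (6,8), (7,8)}" by auto
    moreover have "\<epsilon> 5 + \<epsilon> 6 \<in> ?K"
      using adjoin_block_pair[OF e(1,2), of 5 6] by (simp add: block)
    moreover have "\<epsilon> 5 + \<epsilon> 7 \<in> ?K"
      using adjoin_block_pair[OF e(1,3), of 5 7] by (simp add: block)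
    moreover have "\<epsilon> 5 + \<epsilon> 8 \<in> ?K"
      using adjoin_block_pair[OF e(2,3), of 5 8] by (simp add: block)
    moreover have "\<epsilon> 6 + \<epsilon> 7 \<in> ?K"
      using adjoin_block_pair[OF e(2,3), of 6 7] by (simp add: block)
    moreover have "\<epsilon> 6 + \<epsilon> 8 \<in> ?K"
      using adjoin_block_pair[OF e(1,3), of 6 8] by (simp add: block)
    moreover have "\<epsilon> 7 + \<epsilon> 8 \<in> ?K"
      using adjoin_block_pair[OF e(1,2), of 7 8] by (simp add: block)
    ultimately show ?thesis by auto
  qed
  show "D4_2 \<subseteq> ?K"
    unfolding D4_2_def int_span_eq
  proof (intro int_mod.span_minimal adjoin_subspace, clarify)
    fix s t :: real and i j assume "?P i j" "s \<in> {1, -1}" "t \<in> {1, -1}"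
    then show "s *\<^sub>R \<epsilon> i + t *\<^sub>R \<epsilon> j \<in> ?K"
      by (intro signed_pair_mem[OF adjoin_subspace L pair]) auto
  qed
  have "\<epsilon> 2 \<in> int_span (insert (\<epsilon> 1) D4_2)" "\<epsilon> 3 \<in> int_span (insert (\<epsilon> 1) D4_2)"
    using D4_2_pair[of 1 2] D4_2_pair[of 1 3] by (auto intro!: span_eps_shift[OF D4_2_subspace])
  moreover have "insert (\<epsilon> 1) Lambda8 \<subseteq> int_span (insert (\<epsilon> 1) D4_2)"
    using LD by (auto simp: int_span_eq intro: int_mod.span_base)
  ultimately show "Lambda8 \<union> {\<epsilon> 1, \<epsilon> 2, \<epsilon> 3} \<subseteq> int_span (insert (\<epsilon> 1) D4_2)"
    by blast
qed

lemma D8_dual: "D8 \<subseteq> dual (insert half_sum (\<epsilon> ` {1..8}))"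
  unfolding D8_def int_span_eq
proof (intro int_mod.span_minimal dual_subspace, clarify)
  fix s t :: real and i j :: nat assume "1 \<le> i" "i < j" "j \<le> 8" "s \<in> {1, -1}" "t \<in> {1, -1}"
  then show "s *\<^sub>R \<epsilon> i + t *\<^sub>R \<epsilon> j \<in> dual (insert half_sum (\<epsilon> ` {1..8}))"
    by (intro signed_pair_dual) auto
qed

lemma D8_subset_Z8: "D8 \<subseteq> Z8"
  using D8_dual unfolding Z8_eq dual_def by blast

text \<open>Doubles as the membership test for D_8 in the analysis of its cosets.\<close>

lemma even_part_Z8: "even_part Z8 = D8"
proof (rule even_part_eqI)
  show "int_mod.subspace D8" by (rule D8_subspace)
  show "D8 \<subseteq> dual (insert half_sum (\<epsilon> ` {1..8}))" by (rule D8_dual)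
  have "Lambda8 \<subseteq> D8"
    by (rule Lambda8_subset[OF D8_subspace], rule D8_pair) auto
  then show "2 *\<^sub>R \<epsilon> 1 \<in> D8"
    using two_eps_in_Lambda8[of 1] by auto
  show "int_span (\<epsilon> ` {1..8}) = Z8" by (rule Z8_span)
  show "\<epsilon> 1 \<in> Z8" by (simp add: Z8_eq dual_def)
  show "D8 \<subseteq> Z8" by (rule D8_subset_Z8)
  show "\<epsilon> ` {1..8} \<subseteq> int_span (insert (\<epsilon> 1) D8)"
  proof
    fix x assume "x \<in> \<epsilon> ` {1..8}"
    then obtain i where i: "i \<in> {1..8}" "x = \<epsilon> i" by blast
    show "x \<in> int_span (insert (\<epsilon> 1) D8)"
    proof (cases "i = 1")
      case True
      with i show ?thesis by (auto simp: int_span_eq intro: int_mod.span_base)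
    next
      case False
      with i D8_pair[of 1 i] show ?thesis
        by (auto intro!: span_eps_shift[OF D8_subspace])
    qed
  qed
qed

subsection \<open>Even and self-dual lattices\<close>

text \<open>A basis of M spans the whole space because M contains \<open>Lambda8\<close>. The dual
  basis lies in \<open>dual M\<close>, and pairing x with it reads off the coordinates of x, which
  are therefore integers.\<close>

lemma dual_dual_subset:
  assumes "is_lattice M" "Lambda8 \<subseteq> M"
  shows "dual (dual M) \<subseteq> M"
proof
  obtain B where B: "independent B" "M = int_span B"
    using assms(1) by (auto simp: is_lattice_def)
  have finB: "finite B"
    using B(1) independent_bound by blast
  have sub: "M \<subseteq> span B"
    unfolding B(2) int_span_eq
    by (intro int_mod.span_minimal) (auto simp: int_mod.subspace_def span_base intro: span_zero span_add span_scale)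
  have "\<epsilon> i \<in> span B" if "i \<in> {1..8}" for i
  proof -
    have "2 *\<^sub>R \<epsilon> i \<in> span B"
      using two_eps_in_Lambda8[OF that] assms(2) sub by (meson subsetD)
    then have "(1/2) *\<^sub>R (2 *\<^sub>R \<epsilon> i) \<in> span B"
      by (rule span_scale)
    then show ?thesis by simp
  qed
  then have "(\<Sum>i=1..8. (x \<bullet> \<epsilon> i) *\<^sub>R \<epsilon> i) \<in> span B" for x
    by (intro span_sum span_scale)
  then have univ: "x \<in> span B" for x
    unfolding eps_expand[symmetric] .
  fix x assume x: "x \<in> dual (dual M)"
  obtain u where u: "x = (\<Sum>b\<in>B. u b *\<^sub>R b)"
    using univ[of x] span_finite[OF finB] by auto
  have "u b \<in> \<int>" if b: "b \<in> B" for b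
  proof -
    obtain f :: "real ^ 8 \<Rightarrow> real" where f: "linear f" "\<And>c. c \<in> B \<Longrightarrow> f c = (if c = b then 1 else 0)"
      using linear_independent_extend[OF B(1), of "\<lambda>c. if c = b then 1 else 0"] by blast
    \<comment> \<open>The vector representing the coordinate functional f by the inner product: the
      dual basis vector of b.\<close>
    define y where "y = adjoint f 1"
    have fy: "z \<bullet> y = f z" for z
      using adjoint_works[OF f(1), of z 1] by (simp add: y_def)
    have "y \<in> dual M"
      unfolding B(2) dual_int_span using f(2) by (auto simp: dual_def inner_commute[of y] fy)
    then have "f x \<in> \<int>"
      using x by (auto simp: dual_def fy[symmetric])
    also have "f x = (\<Sum>c\<in>B. u c * f c)"
      by (simp add: u linear_sum[OF f(1)] linear_scale[OF f(1)])
    also have "\<dots> = (\<Sum>c\<in>B. if c = b then u b else 0)"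
      by (intro sum.cong) (simp_all add: f(2))
    also have "\<dots> = u b"
      using finB b by simp
    finally show ?thesis .
  qed
  then have "\<forall>b\<in>B. \<exists>k. u b = of_int k"
    by (meson Ints_cases)
  then obtain k where k: "\<And>b. b \<in> B \<Longrightarrow> u b = of_int (k b)"
    by metis
  have "x = (\<Sum>b\<in>B. of_int (k b) *\<^sub>R b)"
    unfolding u by (intro sum.cong) (simp_all add: k)
  also have "\<dots> \<in> M"
    unfolding B(2) int_span_eq by (intro int_mod.span_sum int_mod.span_scale int_mod.span_base)
  finally show "x \<in> M" .
qed

lemma equivalent_even_part:
  "equivalent (int_span (insert v M)) N \<Longrightarrow> even_part (int_span (insert v M)) = M \<Longrightarrow> equivalent M (even_part N)"
  unfolding equivalent_def using even_part_image by metis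

lemma overlattice_insert:
  assumes "int_mod.subspace M" "Lambda8 \<subseteq> M" "M \<subseteq> dual M" "v \<in> dual M" "v \<bullet> v \<in> \<int>"
  shows "overlattice (int_span (insert v M))"
proof -
  have "insert v M \<subseteq> dual (insert v M)"
    using assms(3-5) by (auto simp: dual_def inner_commute)
  then have "int_span (insert v M) \<subseteq> dual (int_span (insert v M))"
    unfolding dual_int_span unfolding int_span_eq
    by (intro int_mod.span_minimal dual_subspace)
  moreover have "Lambda8 \<subseteq> int_span (insert v M)"
    using assms(2) by (auto simp: int_span_eq intro: int_mod.span_base)
  ultimately show ?thesis
    by (simp add: overlattice_def int_span_eq)
qed

text \<open>The norm of 2v is divisible by 4. Hence vectors of the dual have integral norms, and
  their parity makes sense even where M is not self-dual.\<close>

lemma dual_integral_norm: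
  assumes "Lambda8 \<subseteq> M" "v \<in> dual M"
  shows "2 *\<^sub>R v \<in> Lambda8" "v \<bullet> v \<in> \<int>"
proof -
  have "v \<in> dual Lambda8"
    using assms dual_antimono by blast
  then show *: "2 *\<^sub>R v \<in> Lambda8"
    by (simp add: dual_Lambda8)
  show "v \<bullet> v \<in> \<int>"
    using Lambda8_norm[OF *] by simp
qed

lemma even_overlattice:
  assumes M: "overlattice M" and even: "\<And>x. x \<in> M \<Longrightarrow> x \<bullet> x / 2 \<in> \<int>"
    and v: "v \<in> dual M" "v \<bullet> v / 2 \<notin> \<int>"
  shows "\<exists>N \<in> {Lambda8, adjoin Lambda8 A1_8, D4_2, D8}. equivalent M N"
proof -
  let ?M = "int_span (insert v M)"
  have sub: "int_mod.subspace M" "Lambda8 \<subseteq> M" "M \<subseteq> dual M"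
    using M by (auto simp: overlattice_def)
  have v2: "2 *\<^sub>R v \<in> M" "v \<bullet> v \<in> \<int>"
    using dual_integral_norm[OF sub(2) v(1)] sub(2) by auto
  have "v \<in> ?M"
    by (simp add: int_span_eq int_mod.span_base)
  then obtain N where N: "N \<in> {adjoin Lambda8 {\<epsilon> 1}, adjoin Lambda8 {\<epsilon> 1, \<epsilon> 2},
    adjoin Lambda8 {\<epsilon> 1, \<epsilon> 2, \<epsilon> 3}, Z8}" "equivalent ?M N"
    using odd_overlattice[OF overlattice_insert[OF sub v(1) v2(2)] _ v(2)] by blast
  have "equivalent M (even_part N)"
    using equivalent_even_part[OF N(2)] even_part_insert[OF sub(1) even v(1) v2(2) v(2) v2(1)] .
  with N(1) show ?thesis
    using even_part_Lambda8_1 even_part_Lambda8_2 even_part_Lambda8_3 even_part_Z8 by auto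
qed

text \<open>For M self-dual, the dual of \<open>?M0\<close>, the vectors of M integral against
  \<epsilon>_1, is the union of M and M + \<epsilon>_1. A dual vector w of odd norm is outside the
  even M, so w - \<epsilon>_1 lies in M; as w pairs integrally with \<epsilon>_1, the difference
  even lies in \<open>?M0\<close>.\<close>

lemma neighbour_maximal:
  assumes M: "overlattice M" and even: "\<And>x. x \<in> M \<Longrightarrow> x \<bullet> x / 2 \<in> \<int>" and selfdual: "dual M \<subseteq> M"
  defines "P \<equiv> int_span (insert (\<epsilon> 1) (M \<inter> dual {\<epsilon> 1}))"
  assumes N: "w \<in> dual P" "w \<bullet> w / 2 \<notin> \<int>"
  shows "w \<in> P"
proof -
  let ?M0 = "M \<inter> dual {\<epsilon> 1}"
  have sub: "int_mod.subspace M" "Lambda8 \<subseteq> M" "M \<subseteq> dual M"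
    using M by (auto simp: overlattice_def)
  have w: "w \<bullet> \<epsilon> 1 \<in> \<int>" "\<And>x. x \<in> ?M0 \<Longrightarrow> w \<bullet> x \<in> \<int>"
    using N(1) by (auto simp: P_def dual_int_span) (auto simp: dual_def)
  have "Lambda8 \<subseteq> ?M0"
    using sub(2) by (auto simp: dual_def Lambda8_iff)
  then have "Lambda8 \<subseteq> P"
    by (auto simp: P_def int_span_eq intro: int_mod.span_base)
  then have w2: "2 *\<^sub>R w \<in> Lambda8" "w \<bullet> w \<in> \<int>"
    using dual_integral_norm N(1) by blast+
  have half: "(\<exists>k. u = of_int k / 2 \<and> odd k)" if "2 * u \<in> \<int>" "u \<notin> \<int>" for u :: real
  proof -
    obtain k where k: "2 * u = of_int k"
      using \<open>2 * u \<in> \<int>\<close> by (elim Ints_cases)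
    then have u: "u = of_int k / 2"
      by simp
    then have "odd k"
      using \<open>u \<notin> \<int>\<close> half_int_iff[of k] by metis
    with u show ?thesis by blast
  qed
  have diff: "u - u' \<in> \<int>" if u: "2 * u \<in> \<int>" "u \<notin> \<int>" and u': "2 * u' \<in> \<int>" "u' \<notin> \<int>" for u u' :: real
  proof -
    obtain k k' where k: "u = of_int k / 2" "odd k" "u' = of_int k' / 2" "odd k'"
      using half[OF u] half[OF u'] by blast
    then have "u - u' = of_int (k - k') / 2"
      by (simp add: diff_divide_distrib)
    moreover have "even (k - k')"
      using k by simp
    ultimately show ?thesis
      by (simp only: half_int_iff)
  qed
  have two: "2 * (w \<bullet> x) \<in> \<int>" "2 * (\<epsilon> 1 \<bullet> x) \<in> \<int>" if "x \<in> M" for x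
  proof -
    have x: "x \<in> dual Lambda8"
      using overlattice_subset_dual[OF M] that by blast
    have "x \<bullet> 2 *\<^sub>R w \<in> \<int>"
      using x w2(1) unfolding dual_def by blast
    then show "2 * (w \<bullet> x) \<in> \<int>"
      by (simp add: inner_commute)
    have "2 *\<^sub>R \<epsilon> 1 \<in> Lambda8"
      by (rule two_eps_in_Lambda8) simp
    then have "x \<bullet> 2 *\<^sub>R \<epsilon> 1 \<in> \<int>"
      using x unfolding dual_def by blast
    then show "2 * (\<epsilon> 1 \<bullet> x) \<in> \<int>"
      by (simp add: inner_commute)
  qed
  have "w \<notin> M"
    using even N(2) by blast
  then have "w \<notin> dual M"
    using selfdual by blast
  then obtain z where z: "z \<in> M" "w \<bullet> z \<notin> \<int>"
    by (auto simp: dual_def)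
  have M0: "x \<in> ?M0 \<longleftrightarrow> \<epsilon> 1 \<bullet> x \<in> \<int>" if "x \<in> M" for x
    using that by (simp add: dual_def inner_commute)
  have z1: "\<epsilon> 1 \<bullet> z \<notin> \<int>"
    using w(2) M0[OF z(1)] z(2) by blast
  \<comment> \<open>Modulo 1, both w and \<epsilon>_1 act on M with values 0 and 1/2. Two vectors of
    M on which \<epsilon>_1 is half-integral differ by one of \<open>?M0\<close>, so z forces w to
    be half-integral wherever \<epsilon>_1 is, and the difference is integral.\<close>
  have "(w - \<epsilon> 1) \<bullet> x \<in> \<int>" if x: "x \<in> M" for x
  proof (cases "x \<in> ?M0")
    case True
    then show ?thesis
      using w(2)[OF True] M0[OF x] by (simp add: inner_diff_left)
  next
    case False
    then have x1: "\<epsilon> 1 \<bullet> x \<notin> \<int>"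
      using M0[OF x] by blast
    have zx: "z - x \<in> M"
      using overlattice_diff[OF M z(1) x] .
    have "\<epsilon> 1 \<bullet> (z - x) \<in> \<int>"
      using diff[OF two(2)[OF z(1)] z1 two(2)[OF x] x1] by (simp add: inner_diff_right)
    then have "w \<bullet> (z - x) \<in> \<int>"
      using w(2) M0[OF zx] by blast
    then have "w \<bullet> x \<notin> \<int>"
      using z(2) Ints_add[of "w \<bullet> (z - x)" "w \<bullet> x"] by (auto simp: inner_diff_right)
    then show ?thesis
      using diff[OF two(1)[OF x] _ two(2)[OF x] x1] by (simp add: inner_diff_left)
  qed
  then have "w - \<epsilon> 1 \<in> M"
    using selfdual by (auto simp: dual_def)
  moreover have "(w - \<epsilon> 1) \<bullet> \<epsilon> 1 \<in> \<int>"
    using w(1) by (simp add: inner_diff_left)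
  ultimately have "w - \<epsilon> 1 \<in> ?M0"
    by (simp add: dual_def)
  then have "(w - \<epsilon> 1) + \<epsilon> 1 \<in> P"
    unfolding P_def int_span_eq by (intro int_mod.span_add int_mod.span_base) auto
  then show ?thesis by simp
qed

lemma eps_dual_adjoin:
  assumes "i \<in> {1..8}" "X \<subseteq> \<epsilon> ` {1..8}"
  shows "\<epsilon> i \<in> dual (Lambda8 \<union> X)"
proof -
  have "x \<bullet> \<epsilon> i \<in> \<int>" if "x \<in> Lambda8 \<union> X" for x
    using that assms by (auto simp: Lambda8_iff)
  then show ?thesis
    by (auto simp: dual_def inner_commute[of "\<epsilon> i"])
qed

text \<open>Each proper candidate lies in \<int>^8 and so has every \<epsilon>_i in its dual, yet it
  misses one: some check row is integral on the candidate and takes the value 1/2 at that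
  \<epsilon>_i.\<close>

lemma maximal_odd_eq_Z8:
  assumes N: "N \<in> {adjoin Lambda8 {\<epsilon> 1}, adjoin Lambda8 {\<epsilon> 1, \<epsilon> 2},
    adjoin Lambda8 {\<epsilon> 1, \<epsilon> 2, \<epsilon> 3}, Z8}"
    and max: "\<And>w. w \<in> dual N \<Longrightarrow> w \<bullet> w / 2 \<notin> \<int> \<Longrightarrow> w \<in> N"
  shows "N = Z8"
proof -
  have half: "(1::real) / 2 \<notin> \<int>"
    using half_int_iff[of 1] by simp
  have *: "N \<noteq> adjoin Lambda8 X"
    if i: "i \<in> {1..8}" "X \<subseteq> \<epsilon> ` {1..8}" "\<forall>x\<in>X. x \<bullet> y = 0" "y \<in> checks" "\<epsilon> i \<bullet> y = 1/2" for i X y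
  proof
    assume N: "N = adjoin Lambda8 X"
    have "\<epsilon> i \<in> dual N"
      using eps_dual_adjoin[OF i(1,2)] unfolding N adjoin_def dual_int_span .
    then have "\<epsilon> i \<in> N"
      using max[of "\<epsilon> i"] i(1) half by simp
    moreover have "Lambda8 \<union> X \<subseteq> dual {y}"
      using i(3,4) by (auto simp: dual_def Lambda8_eq_dual)
    then have "N \<subseteq> dual {y}"
      unfolding N by (intro adjoin_least dual_subspace)
    ultimately have "\<epsilon> i \<bullet> y \<in> \<int>"
      by (auto simp: dual_def)
    then show False
      using half i(5) by simp
  qed
  \<comment> \<open>Each of the three check rows below has support disjoint from the adjoined
    indices, and the missing \<epsilon>_i is taken from the support.\<close>
  have "N \<noteq> adjoin Lambda8 {\<epsilon> 1}"
    by (rule *[of 2 _ "(1/2) *\<^sub>R (\<epsilon> 2 + \<epsilon> 4 + \<epsilon> 6 + \<epsilon> 8)"])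
      (simp_all add: checks_def inner_add_right)
  moreover have "N \<noteq> adjoin Lambda8 {\<epsilon> 1, \<epsilon> 2}"
    by (rule *[of 3 _ "(1/2) *\<^sub>R (\<epsilon> 3 + \<epsilon> 4 + \<epsilon> 7 + \<epsilon> 8)"])
      (simp_all add: checks_def inner_add_right)
  moreover have "N \<noteq> adjoin Lambda8 {\<epsilon> 1, \<epsilon> 2, \<epsilon> 3}"
    by (rule *[of 5 _ "(1/2) *\<^sub>R (\<epsilon> 5 + \<epsilon> 6 + \<epsilon> 7 + \<epsilon> 8)"])
      (simp_all add: checks_def inner_add_right)
  ultimately show ?thesis
    using N by blast
qed

text \<open>The cosets of \<open>half_sum\<close> and \<open>half_sum - \<epsilon> 8\<close> exclude
  each other, since their difference would put \<epsilon>_8, of odd norm, into S.\<close>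

lemma E8_unique:
  assumes S: "int_mod.subspace S" "S \<subseteq> dual D8" "\<And>x. x \<in> S \<Longrightarrow> x \<bullet> x / 2 \<in> \<int>" "D8 \<subseteq> S"
    and h: "half_sum \<in> S"
    and cosets: "\<And>x. x \<in> S \<Longrightarrow> x \<in> D8 \<or> x - half_sum \<in> D8 \<or> x - half_sum + \<epsilon> 8 \<in> D8"
  shows "S = E8"
proof
  have E8: "E8 = adjoin D8 {half_sum}"
    by (simp add: E8_def half_sum_def)
  show "E8 \<subseteq> S"
    unfolding E8 using S h by (intro adjoin_least) auto
  have sub: "D8 \<subseteq> E8" "half_sum \<in> E8"
    unfolding E8 using adjoin_superset[of D8 "{half_sum}"] by auto
  show "S \<subseteq> E8"
  proof
    fix x assume x: "x \<in> S"
    have "x - half_sum + \<epsilon> 8 \<notin> D8"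
    proof
      assume "x - half_sum + \<epsilon> 8 \<in> D8"
      then have "x - half_sum + \<epsilon> 8 - (x - half_sum) \<in> S"
        using S x h by (intro int_mod.subspace_diff) (auto intro: int_mod.subspace_diff)
      then have "\<epsilon> 8 \<bullet> \<epsilon> 8 / 2 \<in> \<int>"
        by (intro S(3)) simp
      then show False
        using half_int_iff[of 1] by simp
    qed
    then have "x \<in> D8 \<or> x - half_sum \<in> D8"
      using cosets[OF x] by blast
    then show "x \<in> E8"
    proof
      assume "x - half_sum \<in> D8"
      then have "x - half_sum + half_sum \<in> E8"
        using sub E8 adjoin_subspace by (metis int_mod.subspace_add subsetD)
      then show ?thesis by simp
    qed (use sub in blast)
  qed
qed

text \<open>Coordinates of a vector dual to D_8 are all integral or all half of odd integers. In the
  second case subtracting \<open>half_sum\<close> gives an integral vector; if its norm is odd,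
  adding \<epsilon>_8 makes it even.\<close>

lemma D8_cosets:
  assumes x: "x \<in> dual D8" "x \<bullet> x / 2 \<in> \<int>"
  shows "x \<in> D8 \<or> x - half_sum \<in> D8 \<or> x - half_sum + \<epsilon> 8 \<in> D8"
proof -
  have pair: "x \<bullet> \<epsilon> 1 + x \<bullet> \<epsilon> i \<in> \<int>" "x \<bullet> \<epsilon> 1 - x \<bullet> \<epsilon> i \<in> \<int>" if "i \<in> {2..8}" for i
  proof -
    have "x \<bullet> (\<epsilon> 1 + \<epsilon> i) \<in> \<int>" "x \<bullet> (\<epsilon> 1 - \<epsilon> i) \<in> \<int>"
      using D8_pair[of 1 i] that x(1) by (auto simp: dual_def)
    then show "x \<bullet> \<epsilon> 1 + x \<bullet> \<epsilon> i \<in> \<int>" "x \<bullet> \<epsilon> 1 - x \<bullet> \<epsilon> i \<in> \<int>"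
      by (simp_all add: inner_add_right inner_diff_right)
  qed
  \<comment> \<open>All coordinates are congruent mod 1; this is applied with c = 0 and c =
    1/2.\<close>
  have shift: "x \<bullet> \<epsilon> i - c \<in> \<int>" if "x \<bullet> \<epsilon> 1 - c \<in> \<int>" "i \<in> {1..8}" for i c
  proof (cases "i = 1")
    case False
    then have "x \<bullet> \<epsilon> 1 - c - (x \<bullet> \<epsilon> 1 - x \<bullet> \<epsilon> i) \<in> \<int>"
      using that pair(2)[of i] by (intro Ints_diff[OF that(1)]) auto
    then show ?thesis by (simp add: algebra_simps)
  qed (use that in simp)
  show ?thesis
  proof (cases "x \<bullet> \<epsilon> 1 \<in> \<int>")
    case True
    then have "x \<in> Z8"
      using shift[of 0] by (simp add: Z8_eq dual_def)
    then have "x \<in> even_part Z8"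
      using x(2) by (simp add: even_part_def)
    then show ?thesis
      by (simp add: even_part_Z8)
  next
    case False
    have "(x \<bullet> \<epsilon> 1 + x \<bullet> \<epsilon> 2) + (x \<bullet> \<epsilon> 1 - x \<bullet> \<epsilon> 2) \<in> \<int>"
      by (rule Ints_add; rule pair; simp)
    then obtain k where k: "2 * (x \<bullet> \<epsilon> 1) = of_int k"
      by (auto elim: Ints_cases)
    then have xk: "x \<bullet> \<epsilon> 1 = of_int k / 2"
      by simp
    then have "odd k"
      using False half_int_iff[of k] by metis
    then have "even (k - 1)"
      by simp
    then have "real_of_int (k - 1) / 2 \<in> \<int>"
      by (simp only: half_int_iff)
    then have "x \<bullet> \<epsilon> 1 - 1/2 \<in> \<int>"
      by (simp add: xk diff_divide_distrib)
    then have int: "(x - half_sum) \<bullet> \<epsilon> i \<in> \<int>" if "i \<in> {1..8}" for i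
      using shift[of "1/2" i] that
      by (simp add: inner_diff_left inner_commute[of half_sum] eps_inner_half_sum)
    define y where "y = x - half_sum"
    have y: "y \<in> Z8"
      using int by (simp add: y_def Z8_eq dual_def)
    have y8: "y + \<epsilon> 8 \<in> Z8"
      using y by (rule int_mod.subspace_add[OF Z8_subspace]) (simp add: Z8_eq dual_def)
    show ?thesis
    proof (cases "y \<bullet> y / 2 \<in> \<int>")
      case True
      then have "y \<in> even_part Z8"
        using y by (simp add: even_part_def)
      then show ?thesis
        by (simp add: even_part_Z8 y_def)
    next
      case False
      have "y \<bullet> \<epsilon> 8 \<in> \<int>"
        using y by (simp add: Z8_eq dual_def)
      have "y \<bullet> y \<in> \<int>"
        using y by (subst inner_eps_expand) (auto simp: Z8_eq dual_def)
      then obtain m where m: "y \<bullet> y = of_int m"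
        by (elim Ints_cases)
      then have "odd m"
        using False half_int_iff[of m] by metis
      then have "even (m + 1)"
        by simp
      then have "real_of_int (m + 1) / 2 \<in> \<int>"
        by (simp only: half_int_iff)
      then have "real_of_int (m + 1) / 2 + y \<bullet> \<epsilon> 8 \<in> \<int>"
        using \<open>y \<bullet> \<epsilon> 8 \<in> \<int>\<close> by (rule Ints_add)
      also have "real_of_int (m + 1) / 2 + y \<bullet> \<epsilon> 8 = (y + \<epsilon> 8) \<bullet> (y + \<epsilon> 8) / 2"
        by (simp add: inner_add_left inner_add_right inner_commute m field_simps)
      finally have "y + \<epsilon> 8 \<in> even_part Z8"
        using y8 by (simp add: even_part_def)
      then show ?thesis
        by (simp add: even_part_Z8 y_def)
    qed
  qed
qed

text \<open>A sign change preserves integrality and norm, and D_8 is the even part of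
  \<int>^8.\<close>

lemma reflection_eps_D8:
  assumes "i \<in> {1..8}" "x \<in> D8"
  shows "reflection (\<epsilon> i) x \<in> D8"
proof -
  have x: "x \<in> Z8" "x \<bullet> x / 2 \<in> \<int>"
    using assms(2) even_part_Z8 by (auto simp: even_part_def)
  have "x \<bullet> \<epsilon> i \<in> \<int>"
    using x(1) assms(1) by (simp add: Z8_eq dual_def)
  then obtain k where k: "x \<bullet> \<epsilon> i = of_int k"
    by (elim Ints_cases)
  have "\<epsilon> i \<in> Z8"
    using assms(1) by (auto simp: Z8_eq dual_def)
  then have "of_int (2 * k) *\<^sub>R \<epsilon> i \<in> Z8"
    by (rule int_mod.subspace_scale[OF Z8_subspace])
  with x(1) have "x - of_int (2 * k) *\<^sub>R \<epsilon> i \<in> Z8"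
    by (rule int_mod.subspace_diff[OF Z8_subspace])
  then have "reflection (\<epsilon> i) x \<in> Z8"
    by (simp add: reflection_def k)
  moreover have "reflection (\<epsilon> i) x \<bullet> reflection (\<epsilon> i) x = x \<bullet> x"
    using reflection_orthogonal[of "\<epsilon> i"] assms(1) by (simp add: orthogonal_transformation_def)
  ultimately have "reflection (\<epsilon> i) x \<in> even_part Z8"
    using x(2) by (simp add: even_part_def)
  then show ?thesis
    by (simp add: even_part_Z8)
qed

lemma even_selfdual_over_D8:
  assumes S: "int_mod.subspace S" "S \<subseteq> dual S" "dual S \<subseteq> S" "D8 \<subseteq> S"
    and even: "\<And>x. x \<in> S \<Longrightarrow> x \<bullet> x / 2 \<in> \<int>"
  shows "\<exists>g. orthogonal_transformation g \<and> g ` S = E8"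
proof -
  have dD: "S \<subseteq> dual D8"
    using S(2,4) dual_antimono by blast
  have cosets: "x \<in> D8 \<or> x - half_sum \<in> D8 \<or> x - half_sum + \<epsilon> 8 \<in> D8" if "x \<in> S" for x
    using D8_cosets[of x] dD even that by blast
  \<comment> \<open>D_8 is not self-dual, since \<epsilon>_1 is in its dual but cannot be in the
    even lattice S = \<open>dual S\<close>. So S contains a vector x outside D_8, which lies in one
    of the two spinor cosets.\<close>
  have "\<epsilon> 1 \<bullet> \<epsilon> 1 / 2 \<notin> \<int>"
    using half_int_iff[of 1] by simp
  then have "\<epsilon> 1 \<notin> S"
    using even by blast
  then have "\<epsilon> 1 \<notin> dual S"
    using S(3) by blast
  moreover have "\<epsilon> 1 \<in> dual D8"
    using D8_dual by (rule eps_1_dual)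
  ultimately obtain x where x: "x \<in> S" "x \<notin> D8"
    using dual_antimono[of S D8] by blast
  show ?thesis
  proof (cases "half_sum \<in> S")
    case True
    have "S = E8"
      using E8_unique[OF S(1) dD even S(4) True cosets] .
    then show ?thesis
      using orthogonal_transformation_id by (metis image_ident)
  next
    case False
    have "x - half_sum \<notin> D8"
    proof
      assume "x - half_sum \<in> D8"
      then have "x - (x - half_sum) \<in> S"
        using int_mod.subspace_diff[OF S(1) x(1), of "x - half_sum"] S(4) by blast
      with False show False by simp
    qed
    then have "x - half_sum + \<epsilon> 8 \<in> D8"
      using cosets[OF x(1)] x(2) by blast
    then have "x - (x - half_sum + \<epsilon> 8) \<in> S"
      using int_mod.subspace_diff[OF S(1) x(1), of "x - half_sum + \<epsilon> 8"] S(4) by blast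
    then have h8: "half_sum - \<epsilon> 8 \<in> S"
      by simp
    define g where "g = reflection (\<epsilon> 8)"
    have e8: "\<epsilon> 8 \<bullet> \<epsilon> 8 = 1"
      by simp
    have g: "orthogonal_transformation g"
      unfolding g_def by (rule reflection_orthogonal[OF e8])
    have hs: "half_sum \<bullet> \<epsilon> 8 = 1/2"
      using eps_inner_half_sum[of 8] by (simp add: inner_commute)
    \<comment> \<open>The reflection changes the last sign, which exchanges the two glue vectors
      while D_8 stays put.\<close>
    have "g (half_sum - \<epsilon> 8) = half_sum"
      by (simp add: g_def reflection_def inner_diff_left hs)
    then have gh: "half_sum \<in> g ` S"
      using h8 by (metis imageI)
    have gD: "D8 \<subseteq> g ` S"
    proof
      fix d assume "d \<in> D8"
      then have "g d \<in> S"
        using reflection_eps_D8[of 8 d] S(4) by (auto simp: g_def)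
      then have "g (g d) \<in> g ` S"
        by blast
      then show "d \<in> g ` S"
        unfolding g_def reflection_involutive[OF e8] .
    qed
    have "g ` S \<subseteq> dual (g ` S)"
      using S(2) by (simp add: dual_image[OF g] image_mono)
    then have gdD: "g ` S \<subseteq> dual D8"
      using gD dual_antimono by blast
    have geven: "y \<bullet> y / 2 \<in> \<int>" if "y \<in> g ` S" for y
      using that even g by (auto simp: orthogonal_transformation_def)
    have gcosets: "y \<in> D8 \<or> y - half_sum \<in> D8 \<or> y - half_sum + \<epsilon> 8 \<in> D8" if "y \<in> g ` S" for y
      using D8_cosets[of y] gdD geven that by blast
    have "g ` S = E8"
      using E8_unique[OF subspace_image[OF orthogonal_transformation_linear[OF g] S(1)] gdD geven gD gh gcosets] .
    with g show ?thesis by blast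
  qed
qed

lemma even_selfdual_overlattice:
  assumes M: "overlattice M" and even: "\<And>x. x \<in> M \<Longrightarrow> x \<bullet> x / 2 \<in> \<int>" and selfdual: "dual M \<subseteq> M"
  shows "\<exists>g. orthogonal_transformation g \<and> g ` M = E8"
proof -
  let ?M0 = "M \<inter> dual {\<epsilon> 1}"
  let ?P = "int_span (insert (\<epsilon> 1) ?M0)"
  have sub: "int_mod.subspace M" "Lambda8 \<subseteq> M" "M \<subseteq> dual M"
    using M by (auto simp: overlattice_def)
  have sub0: "int_mod.subspace ?M0"
    using sub(1) dual_subspace by (rule int_mod.subspace_inter)
  have L0: "Lambda8 \<subseteq> ?M0"
    using sub(2) by (auto simp: dual_def Lambda8_iff)
  have M0: "?M0 \<subseteq> dual ?M0"
    using sub(3) dual_antimono[of ?M0 M] by blast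
  have e1: "\<epsilon> 1 \<in> dual ?M0" "\<epsilon> 1 \<bullet> \<epsilon> 1 \<in> \<int>" "\<epsilon> 1 \<bullet> \<epsilon> 1 / 2 \<notin> \<int>" "2 *\<^sub>R \<epsilon> 1 \<in> ?M0"
    using half_int_iff[of 1] L0 two_eps_in_Lambda8[of 1] by (auto simp: dual_def inner_commute)
  have P: "overlattice ?P"
    using overlattice_insert[OF sub0 L0 M0 e1(1,2)] .
  have "\<epsilon> 1 \<in> ?P"
    by (simp add: int_span_eq int_mod.span_base)
  then obtain N where N: "N \<in> {adjoin Lambda8 {\<epsilon> 1}, adjoin Lambda8 {\<epsilon> 1, \<epsilon> 2},
    adjoin Lambda8 {\<epsilon> 1, \<epsilon> 2, \<epsilon> 3}, Z8}" "equivalent ?P N"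
    using odd_overlattice[OF P _ e1(3)] by blast
  then obtain g where g: "orthogonal_transformation g" "g ` ?P = N"
    unfolding equivalent_def by blast
  \<comment> \<open>Duals and norms are transported by g, so N inherits the maximality of the
    neighbour.\<close>
  have "N = Z8"
  proof (rule maximal_odd_eq_Z8[OF N(1)])
    fix w assume w: "w \<in> dual N" "w \<bullet> w / 2 \<notin> \<int>"
    then have "w \<in> g ` dual ?P"
      using dual_image[OF g(1)] g(2) by metis
    then obtain u where u: "w = g u" "u \<in> dual ?P"
      by (rule imageE)
    have "u \<bullet> u / 2 \<notin> \<int>"
      using w(2) g(1) by (simp add: u(1) orthogonal_transformation_def)
    then have "u \<in> ?P"
      using neighbour_maximal[OF M even selfdual u(2)] by blast
    then show "w \<in> N"
      using g(2) u(1) by blast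
  qed
  \<comment> \<open>The even part of the neighbour is its intersection with M, and g carries it to
    the even part of \<int>^8. This is how D_8 gets inside the image of M.\<close>
  have "even_part ?P = ?M0"
    using even_part_insert[OF sub0 _ e1] even by blast
  then have "g ` ?M0 = D8"
    using even_part_image[OF g(1), of ?P] even_part_Z8 g(2) \<open>N = Z8\<close> by simp
  then have "D8 \<subseteq> g ` M"
    by blast
  moreover have "g ` M \<subseteq> dual (g ` M)" "dual (g ` M) \<subseteq> g ` M"
    using sub(3) selfdual by (simp_all add: dual_image[OF g(1)] image_mono)
  moreover have "y \<bullet> y / 2 \<in> \<int>" if "y \<in> g ` M" for y
    using that even g(1) by (auto simp: orthogonal_transformation_def)
  moreover have "int_mod.subspace (g ` M)"
    using subspace_image[OF orthogonal_transformation_linear[OF g(1)] sub(1)] .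
  ultimately obtain f where f: "orthogonal_transformation f" "f ` g ` M = E8"
    using even_selfdual_over_D8[of "g ` M"] by blast
  have "(f \<circ> g) ` M = E8"
    using f(2) by (simp only: image_comp)
  then show ?thesis
    using orthogonal_transformation_compose[OF f(1) g(1)] by blast
qed

section \<open>The three cases: odd, even with odd dual, even with even dual\<close>

lemma equivalent_isometric: "equivalent M N \<Longrightarrow> isometric_lattices M N"
  by (auto simp: equivalent_def isometric_lattices_def)

theorem theorem9p1:
  fixes M :: "(real ^ 8) set"
  assumes "integral_lattice M" and "Lambda8 \<subseteq> M"
  shows "\<exists>N \<in> {Lambda8, adjoin Lambda8 {\<epsilon> 1}, adjoin Lambda8 {\<epsilon> 1, \<epsilon> 2},
                adjoin Lambda8 {\<epsilon> 1, \<epsilon> 2, \<epsilon> 3}, Z8,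
                adjoin Lambda8 A1_8, D4_2, D8, E8}. isometric_lattices M N"
proof -
  have lat: "is_lattice M" and sub: "M \<subseteq> dual M"
    using assms(1) by (auto simp: integral_lattice_def dual_def)
  have M: "overlattice M"
    using lat sub assms(2) by (auto simp: overlattice_def is_lattice_def int_span_eq)
  consider x where "x \<in> M" "x \<bullet> x / 2 \<notin> \<int>"
    | v where "\<And>x. x \<in> M \<Longrightarrow> x \<bullet> x / 2 \<in> \<int>" "v \<in> dual M" "v \<bullet> v / 2 \<notin> \<int>"
    | "\<And>x. x \<in> M \<Longrightarrow> x \<bullet> x / 2 \<in> \<int>" "\<And>v. v \<in> dual M \<Longrightarrow> v \<bullet> v / 2 \<in> \<int>"
    by blast
  then show ?thesis
  proof cases
    case 1
    then show ?thesis
      using odd_overlattice[OF M] equivalent_isometric by blast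
  next
    case 2
    then show ?thesis
      using even_overlattice[OF M] equivalent_isometric by blast
  next
    case 3
    \<comment> \<open>Polarization: even norms on the whole dual make the dual integral, hence
      contained in its own dual, and biduality brings it back into M.\<close>
    have "v \<bullet> w \<in> \<int>" if "v \<in> dual M" "w \<in> dual M" for v w
    proof -
      have "v + w \<in> dual M"
        using that by (rule int_mod.subspace_add[OF dual_subspace])
      then have "(v + w) \<bullet> (v + w) / 2 - v \<bullet> v / 2 - w \<bullet> w / 2 \<in> \<int>"
        using that by (intro Ints_diff 3(2))
      also have "(v + w) \<bullet> (v + w) / 2 - v \<bullet> v / 2 - w \<bullet> w / 2 = v \<bullet> w"
        by (simp add: inner_add_left inner_add_right inner_commute field_simps)
      finally show ?thesis .
    qed
    then have "dual M \<subseteq> dual (dual M)"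
      by (auto simp: dual_def[of "dual M"])
    then have "dual M \<subseteq> M"
      using dual_dual_subset[OF lat assms(2)] by blast
    then show ?thesis
      using even_selfdual_overlattice[OF M 3(1)] by (auto simp: isometric_lattices_def)
  qed
qed

end
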